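(* Let $p<q$ be square-free integers $\ge 2$ with $p\equiv q\equiv 1\pmod 4$, put $r=pq/\gcd(p,q)^2$ and assume $p<q<r$. Let $K=\mathbb{Q}(\sqrt p,\sqrt q)$, $F_1=\mathbb{Q}(\sqrt p)$, $F_2=\mathbb{Q}(\sqrt q)$, and let $m$ be a positive integer. (1) Suppose $m\le\min\{\frac{r}{16(\kappa\sqrt r+1)},\,p,\,q\}$ for some positive integer $\kappa$. If $p\ge(m+8)^2$ and $q\ge(m+8)^2$, then not all elements of $m\mathcal{O}_{F_1}^+$ are sums of squares of elements of $\mathcal{O}_K$, and not all elements of $m\mathcal{O}_{F_2}^+$ are sums of squares of elements of $\mathcal{O}_K$. (2) Suppose $\sqrt p+\sqrt q+1>\sqrt r$ and $m<\frac{\sqrt r}{24\kappa}$ for some positive integer $\kappa$, where $\kappa$ is required to be even if $\gcd(p,q)\equiv1\pmod 4$. Put $N_1=\frac{\sqrt q+\sqrt r+4}{4}$ and $N_2=\frac{\sqrt p+\sqrt r+4}{4}$. If $p\ge\left(\frac m2+2\sqrt{mN_1}\right)^2$ and $q\ge\left(m+\sqrt{8mN_2}\right)^2$, then not all elements of $m\mathcal{O}_K^+$ are sums of squares of elements of $\mathcal{O}_K$.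
   Context: For a totally real number field $F$, $\mathcal{O}_F$ is its ring of integers, $\mathcal{O}_F^+$ is the set of totally positive elements of $\mathcal{O}_F$ (all real embeddings positive), and $m\mathcal{O}_F^+=\{m\alpha:\alpha\in\mathcal{O}_F^+\}$. A sum of squares in $\mathcal{O}_K$ is a finite sum $\sum_i\alpha_i^2$ with $\alpha_i\in\mathcal{O}_K$. *)

theory Defs
  imports
    "HOL-Analysis.Analysis"
    "HOL-Computational_Algebra.Squarefree"
    "HOL-Number_Theory.Cong"
    "HOL-Algebra.Generated_Fields"
    "HOL-Algebra.Algebraic_Closure_Type"
begin

abbreviation real_ring :: "real ring" where
  "real_ring \<equiv> ring_of_type_algebra"

text \<open>Number fields are taken as subfields of the reals. A subfield of the reals contains
  the rationals, so the subfield generated by \<open>S\<close> is \<open>\<rat>(S)\<close>.\<close>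

definition rat_adjoin :: "real set \<Rightarrow> real set" where
  "rat_adjoin S = generate_field real_ring S"

definition ring_of_integers :: "real set \<Rightarrow> real set" where
  "ring_of_integers F = {x \<in> F. algebraic_int x}"

text \<open>Homomorphisms are only constrained on \<open>F\<close>; being unital, they are injective there.\<close>

definition real_embeddings :: "real set \<Rightarrow> (real \<Rightarrow> real) set" where
  "real_embeddings F = ring_hom (real_ring\<lparr>carrier := F\<rparr>) real_ring"

definition tot_pos_integers :: "real set \<Rightarrow> real set" where
  "tot_pos_integers F = {x \<in> ring_of_integers F. \<forall>\<sigma> \<in> real_embeddings F. \<sigma> x > 0}"

definition sums_of_squares :: "real set \<Rightarrow> real set" where
  "sums_of_squares A = {x. \<exists>(n::nat) a. (\<forall>i<n. a i \<in> A) \<and> x = (\<Sum>i<n. (a i)\<^sup>2)}"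

end

theory Submission
  imports Defs "Jordan_Normal_Form.Char_Poly"
begin

text \<open>
  Write \<open>g = gcd(p, q)\<close>, \<open>p = g d\<close>, \<open>q = g e\<close>, so that \<open>r = d e\<close> and
  \<open>g < d < e\<close>. Four times an integer of \<open>K\<close> has the form \<open>x + y \<surd>p + z \<surd>q + t \<surd>r\<close> with
  integers \<open>x \<equiv> y \<equiv> z \<equiv> t (mod 2)\<close>, so a sum of squares in \<open>\<O>\<^sub>K\<close> is a system of integral
  quadratic equations.

  Trace argument: if the trace of \<open>m \<alpha>\<close> is less than \<open>r/4\<close>, then all \<open>t\<close> vanish, so \<open>x, y, z\<close>
  are even, and the Cauchy--Schwarz inequality for the coefficient of \<open>\<surd>p\<close> bounds the trace
  from below. This contradicts the choice of a totally positive \<open>\<alpha>\<close> whose trace is almost as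
  small as possible: \<open>\<alpha> = (a \<plusminus> \<surd>p + \<surd>q + \<surd>r)/4\<close> for \<open>K\<close>, and \<open>\<alpha> = (a + \<surd>q)/2\<close> for \<open>F\<^sub>2\<close> if
  \<open>d \<le> 4 m\<close>.

  Descent: if \<open>e > 4 m\<close> and all of \<open>m \<O>\<^sub>F\<^sup>+\<close> with \<open>F = \<rat>(\<surd>p)\<close> are sums of squares in \<open>\<O>\<^sub>K\<close>,
  then they are already sums of squares in \<open>\<O>\<^sub>F\<close>. The latter is impossible for
  \<open>p \<ge> (m + 8)\<^sup>2\<close>: for suitable \<open>b\<close> and \<open>a\<close> slightly larger than \<open>b \<surd>p\<close>, a representation of
  \<open>m (a + b \<surd>p)/2\<close> would make \<open>Y = \<Sum>y\<^sup>2\<close> an integer of the parity of \<open>m b\<close> with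
  \<open>(Y \<surd>p - m b)\<^sup>2 \<le> 4 m Y\<close>, and there is none. For \<open>F\<^sub>2\<close> the roles of \<open>d\<close> and \<open>e\<close> are exchanged.
\<close>

section \<open>Sums and products of algebraic integers\<close>

interpretation int_span: Modules.module "\<lambda>(n::int) (x::real). of_int n * x"
  by standard (auto simp: algebra_simps)

text \<open>The hypothesis makes \<open>v\<close> an eigenvector of the integer matrix
  \<open>c\<close> with eigenvalue \<open>z\<close>, so \<open>z\<close> is a root of the
  characteristic polynomial, which is monic with integer coefficients.\<close>

lemma algebraic_int_if_int_matrix:
  fixes v :: "nat \<Rightarrow> real" and c :: "nat \<Rightarrow> nat \<Rightarrow> int"
  assumes "\<And>i. i < n \<Longrightarrow> z * v i = (\<Sum>j<n. of_int (c i j) * v j)"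
    and "k < n" "v k \<noteq> 0"
  shows "algebraic_int z"
proof -
  define A where "A = mat n n (\<lambda>(i, j). c i j)"
  define B where "B = (map_mat of_int A :: real mat)"
  have A: "A \<in> carrier_mat n n" and B: "B \<in> carrier_mat n n"
    by (auto simp: A_def B_def)
  have "eigenvector B (vec n v) z"
    unfolding eigenvector_def
  proof (intro conjI)
    show "vec n v \<in> carrier_vec (dim_row B)"
      using B by auto
    show "vec n v \<noteq> 0\<^sub>v (dim_row B)"
    proof
      assume "vec n v = 0\<^sub>v (dim_row B)"
      then have "vec_index (vec n v) k = vec_index (0\<^sub>v (dim_row B)) k" by simp
      then show False using assms(2,3) B by simp
    qed
    show "B *\<^sub>v vec n v = z \<cdot>\<^sub>v vec n v"
      by (rule eq_vecI)
        (auto simp: B_def A_def scalar_prod_def assms(1) atLeast0LessThan)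
  qed
  then have "eigenvalue B z" unfolding eigenvalue_def by blast
  then have "poly (char_poly B) z = 0"
    using eigenvalue_root_char_poly[OF B] by blast
  moreover have "char_poly B = map_poly of_int (char_poly A)"
    unfolding B_def by (rule of_int_hom.char_poly_hom[OF A])
  moreover have "Polynomial.lead_coeff (char_poly A) = 1"
    using degree_monic_char_poly[OF A] by simp
  ultimately show ?thesis
    unfolding algebraic_int_altdef_ipoly by auto
qed

text \<open>Expanding every \<open>z * s\<close> in the generators yields an integer matrix whose
  eigenvector lists the elements of \<open>S\<close>; \<open>s0\<close> supplies its nonzero
  entry.\<close>

lemma algebraic_int_if_stable_span:
  assumes "finite S" "s0 \<in> S" "s0 \<noteq> 0"
    and stable: "\<And>s. s \<in> S \<Longrightarrow> z * s \<in> int_span.span S"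
  shows "algebraic_int z"
proof -
  obtain v where v: "bij_betw v {0..<card S} S"
    using ex_bij_betw_nat_finite[OF assms(1)] by blast
  have "\<exists>c. \<forall>i<card S. z * v i = (\<Sum>j<card S. of_int (c i j) * v j)"
  proof -
    have "\<exists>c. z * v i = (\<Sum>j<card S. of_int (c j) * v j)" if "i < card S" for i
    proof -
      have "v i \<in> S" using v that by (auto simp: bij_betw_def)
      from stable[OF this] obtain u where "z * v i = (\<Sum>s\<in>S. of_int (u s) * s)"
        unfolding int_span.span_finite[OF assms(1)] by auto
      also have "\<dots> = (\<Sum>j\<in>{0..<card S}. of_int (u (v j)) * v j)"
        using sum.reindex_bij_betw[OF v, of "\<lambda>s. of_int (u s) * s"] by simp
      finally show ?thesis by (auto simp: atLeast0LessThan)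
    qed
    then show ?thesis by metis
  qed
  then obtain c where "\<And>i. i < card S \<Longrightarrow> z * v i = (\<Sum>j<card S. of_int (c i j) * v j)"
    by blast
  moreover obtain k where "k < card S" "v k = s0"
    using bij_betw_imp_surj_on[OF v] assms(2) by (metis atLeastLessThan_iff imageE)
  ultimately show ?thesis
    using algebraic_int_if_int_matrix[of "card S" z v c k] assms(3) by blast
qed

lemma algebraic_int_power_reduction:
  fixes x :: real
  assumes "algebraic_int x"
  obtains n c where "n > 0" "x ^ n = (\<Sum>i<n. of_int (c i) * x ^ i)"
proof -
  from assms obtain f :: "int poly" where f: "poly (map_poly of_int f) x = 0" "Polynomial.lead_coeff f = 1"
    unfolding algebraic_int_altdef_ipoly by blast
  have deg: "Polynomial.degree f > 0"
  proof (rule ccontr)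
    assume "\<not> Polynomial.degree f > 0"
    then obtain a where "f = [:a:]" by (auto elim: degree_eq_zeroE)
    with f show False by simp
  qed
  have "0 = (\<Sum>i\<le>Polynomial.degree f. of_int (Polynomial.coeff f i) * x ^ i)"
    using f(1) by (simp add: poly_altdef)
  also have "\<dots> = (\<Sum>i<Polynomial.degree f. of_int (Polynomial.coeff f i) * x ^ i) + x ^ Polynomial.degree f"
    using f(2) by (simp add: lessThan_Suc_atMost[symmetric])
  finally have "x ^ Polynomial.degree f = (\<Sum>i<Polynomial.degree f. of_int (- Polynomial.coeff f i) * x ^ i)"
    by (simp add: sum_negf)
  with deg show ?thesis by (rule that)
qed

text \<open>The monomials \<open>x ^ i * y ^ j\<close> with \<open>i < n\<close> and
  \<open>j < m\<close> span a module stable under \<open>x\<close> and \<open>y\<close>, hence under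
  their sum and product. Powers that overflow are rewritten by the monic equations.\<close>

lemma algebraic_int_add_mult:
  fixes x y :: real
  assumes "algebraic_int x" "algebraic_int y"
  shows "algebraic_int (x + y)" "algebraic_int (x * y)"
proof -
  obtain n c where n: "n > 0" "x ^ n = (\<Sum>i<n. of_int (c i) * x ^ i)"
    using algebraic_int_power_reduction[OF assms(1)] by blast
  obtain m d where m: "m > 0" "y ^ m = (\<Sum>i<m. of_int (d i) * y ^ i)"
    using algebraic_int_power_reduction[OF assms(2)] by blast
  define S where "S = (\<lambda>(i, j). x ^ i * y ^ j) ` ({..<n} \<times> {..<m})"
  have S: "x ^ i * y ^ j \<in> int_span.span S" if "i < n" "j < m" for i j
    using that by (intro int_span.span_base) (auto simp: S_def)
  have xS: "x * s \<in> int_span.span S" if "s \<in> S" for s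
  proof -
    obtain i j where ij: "i < n" "j < m" "s = x ^ i * y ^ j" using \<open>s \<in> S\<close> by (auto simp: S_def)
    show ?thesis
    proof (cases "Suc i < n")
      case True
      then show ?thesis using S[of "Suc i" j] ij by (simp add: mult.assoc)
    next
      case False
      then have "x * s = x ^ n * y ^ j" using ij by (cases n) (auto simp: less_Suc_eq)
      also have "\<dots> = (\<Sum>k<n. of_int (c k) * (x ^ k * y ^ j))"
        by (simp add: n(2) sum_distrib_right mult.assoc)
      also have "\<dots> \<in> int_span.span S"
        using S ij by (intro int_span.span_sum int_span.span_scale) auto
      finally show ?thesis .
    qed
  qed
  have yS: "y * s \<in> int_span.span S" if "s \<in> S" for s
  proof -
    obtain i j where ij: "i < n" "j < m" "s = x ^ i * y ^ j" using \<open>s \<in> S\<close> by (auto simp: S_def)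
    show ?thesis
    proof (cases "Suc j < m")
      case True
      then show ?thesis using S[of i "Suc j"] ij by (simp add: mult_ac)
    next
      case False
      then have "y * s = x ^ i * y ^ m" using ij by (cases m) (auto simp: less_Suc_eq mult_ac)
      also have "\<dots> = (\<Sum>k<m. of_int (d k) * (x ^ i * y ^ k))"
        by (simp add: m(2) sum_distrib_left mult_ac)
      also have "\<dots> \<in> int_span.span S"
        using S ij by (intro int_span.span_sum int_span.span_scale) auto
      finally show ?thesis .
    qed
  qed
  \<comment> \<open>For the product, \<open>x\<close> has to act on the whole span, since
    \<open>y * s\<close> is in general only a combination of generators.\<close>
  have x_span: "x * s \<in> int_span.span S" if "s \<in> int_span.span S" for s
    using that
  proof (induction rule: int_span.span_induct_alt)
    case base then show ?case by (simp add: int_span.span_zero)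
  next
    case (step c s t)
    then have "of_int c * (x * s) + x * t \<in> int_span.span S"
      using xS by (intro int_span.span_add int_span.span_scale) auto
    then show ?case by (simp add: algebra_simps)
  qed
  have fin: "finite S" "x ^ 0 * y ^ 0 \<in> S"
    using n m by (auto simp: S_def intro!: image_eqI[of _ _ "(0,0)"])
  show "algebraic_int (x + y)"
    using fin by (rule algebraic_int_if_stable_span)
      (auto simp: distrib_right intro: int_span.span_add xS yS)
  show "algebraic_int (x * y)"
    using fin by (rule algebraic_int_if_stable_span)
      (auto simp: mult.assoc intro: x_span yS)
qed

section \<open>Integers of a real quadratic field\<close>

text \<open>\<open>conj\<close> stands for the graph of a field automorphism. It transports values
  of integer polynomials, so a monic equation of \<open>x\<close> is also one of \<open>y\<close>. A
  relation spares the definition of a function through unique coordinates.\<close>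

lemma algebraic_int_conjugate:
  fixes conj :: "real \<Rightarrow> real \<Rightarrow> bool"
  assumes of_int: "\<And>k. conj (of_int k) (of_int k)"
    and add: "\<And>x y x' y'. conj x y \<Longrightarrow> conj x' y' \<Longrightarrow> conj (x + x') (y + y')"
    and mult: "\<And>x y x' y'. conj x y \<Longrightarrow> conj x' y' \<Longrightarrow> conj (x * x') (y * y')"
    and zero: "\<And>y. conj 0 y \<Longrightarrow> y = 0"
    and "conj x y" "algebraic_int x"
  shows "algebraic_int y"
proof -
  have poly: "conj (poly (map_poly of_int f) x) (poly (map_poly of_int f) y)" for f :: "int poly"
  proof (induction f)
    case 0
    then show ?case using of_int[of 0] by simp
  next
    case (pCons k f)
    then show ?case
      using add[OF of_int[of k] mult[OF \<open>conj x y\<close> pCons.IH]] by (simp add: map_poly_pCons)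
  qed
  obtain f :: "int poly" where f: "poly (map_poly of_int f) x = 0" "Polynomial.lead_coeff f = 1"
    using \<open>algebraic_int x\<close> unfolding algebraic_int_altdef_ipoly by blast
  with poly[of f] zero have "poly (map_poly of_int f) y = 0" by simp
  with f(2) show ?thesis unfolding algebraic_int_altdef_ipoly by blast
qed

text \<open>If v = h/k in lowest terms, then k^2 divides n h^2 and hence n, which forces k =
  1.\<close>

lemma rat_square_times_squarefree_int:
  fixes n :: int
  assumes "squarefree n" "v \<in> \<rat>" "of_int n * v\<^sup>2 \<in> (\<int> :: real set)"
  shows "v \<in> \<int>"
proof -
  obtain h k where k: "k > 0" "coprime h k" and v: "v = of_int h / of_int k"
    using Rats_cases'[OF assms(2)] by metis
  obtain N where "of_int n * v\<^sup>2 = (of_int N :: real)" using assms(3) by (elim Ints_cases)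
  then have "of_int n * (of_int h)\<^sup>2 = (of_int N * (of_int k)\<^sup>2 :: real)"
    using k(1) by (simp add: v power_divide field_simps)
  then have "real_of_int (n * h\<^sup>2) = of_int (N * k\<^sup>2)" by simp
  then have "n * h\<^sup>2 = N * k\<^sup>2" by (rule of_int_eq_iff[THEN iffD1])
  then have "k\<^sup>2 dvd n * h\<^sup>2" by simp
  moreover have "coprime (k\<^sup>2) (h\<^sup>2)" using k(2) by (simp add: coprime_commute)
  ultimately have "k\<^sup>2 dvd n" by (simp add: coprime_dvd_mult_left_iff)
  with assms(1) have "k dvd 1" unfolding squarefree_def by simp
  with k(1) have "k = 1" by simp
  with v show ?thesis by simp
qed

lemma sqrt_squarefree_irrational:
  fixes n :: int
  assumes "squarefree n" "n > 1"
  shows "sqrt (of_int n) \<notin> \<rat>"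
proof
  assume "sqrt (of_int n) \<in> \<rat>"
  then have "sqrt (of_int n) \<in> \<int>"
    using algebraic_int_sqrt[OF int_imp_algebraic_int] by (intro rational_algebraic_int_is_int) simp_all
  then obtain k where k: "sqrt (of_int n) = of_int k" by (elim Ints_cases)
  have "(sqrt (of_int n))\<^sup>2 = of_int n" using assms(2) by (intro real_sqrt_pow2) simp
  then have "real_of_int (k\<^sup>2) = of_int n" unfolding k by simp
  then have k: "k\<^sup>2 = n" by (rule of_int_eq_iff[THEN iffD1])
  then have "k dvd 1" using assms(1) unfolding squarefree_def by (metis dvd_refl)
  then have "\<bar>k\<bar> = 1" by (simp add: zdvd1_eq)
  then have "k\<^sup>2 = 1" by (metis one_power2 power2_abs)
  with k assms(2) show False by simp
qed

lemma irrational_lin_indep: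
  assumes "s \<notin> \<rat>" "u \<in> \<rat>" "v \<in> \<rat>" "u + v * s = (0 :: real)"
  shows "u = 0" "v = 0"
proof -
  show "v = 0"
  proof (rule ccontr)
    assume "v \<noteq> 0"
    then have "s = - u / v" using assms(4) by (simp add: field_simps)
    then show False using assms by simp
  qed
  with assms(4) show "u = 0" by simp
qed

text \<open>Trace and norm are rational algebraic integers, hence integers. The trace gives x = 2u,
  the norm N gives n (2v)^2 = x^2 - 4N and so an integer y = 2v, and x^2 - n y^2 = 4N with n odd
  gives the parity.\<close>

lemma algebraic_int_quadratic_coeffs:
  fixes n :: int and u v :: real
  assumes n: "squarefree n" "n > 1" "n mod 4 = 1"
    and uv: "u \<in> \<rat>" "v \<in> \<rat>" and int: "algebraic_int (u + v * sqrt (of_int n))"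
  obtains x y where "u = of_int x / 2" "v = of_int y / 2" "even (x - y)"
proof -
  define s where "s = sqrt (of_int n :: real)"
  have s: "s * s = of_int n" "s \<notin> \<rat>"
    using n(2) sqrt_squarefree_irrational[OF n(1,2)] unfolding s_def by simp_all
  define conj where "conj x y \<longleftrightarrow> (\<exists>a\<in>\<rat>. \<exists>b\<in>\<rat>. x = a + b * s \<and> y = a - b * s)" for x y
  have conjI: "conj x y" if "a \<in> \<rat>" "b \<in> \<rat>" "x = a + b * s" "y = a - b * s" for x y a b
    using that unfolding conj_def by blast
  have int': "algebraic_int (u - v * s)"
  proof (rule algebraic_int_conjugate[of conj])
    show "conj (of_int k) (of_int k)" for k by (rule conjI[of "of_int k" 0]) auto
    show "conj (x + x') (y + y')" if xy: "conj x y" "conj x' y'" for x x' y y'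
    proof -
      obtain a b a' b' where *: "a \<in> \<rat>" "b \<in> \<rat>" "x = a + b * s" "y = a - b * s"
        "a' \<in> \<rat>" "b' \<in> \<rat>" "x' = a' + b' * s" "y' = a' - b' * s"
        using xy unfolding conj_def by blast
      have "x + x' = (a + a') + (b + b') * s" "y + y' = (a + a') - (b + b') * s"
        unfolding * by (simp_all add: algebra_simps)
      then show ?thesis using *(1,2,5,6) by (intro conjI[of "a + a'" "b + b'"]) simp_all
    qed
    show "conj (x * x') (y * y')" if xy: "conj x y" "conj x' y'" for x x' y y'
    proof -
      obtain a b a' b' where *: "a \<in> \<rat>" "b \<in> \<rat>" "x = a + b * s" "y = a - b * s"
        "a' \<in> \<rat>" "b' \<in> \<rat>" "x' = a' + b' * s" "y' = a' - b' * s"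
        using xy unfolding conj_def by blast
      have "x * x' = (a * a' + b * b' * of_int n) + (a * b' + a' * b) * s"
        "y * y' = (a * a' + b * b' * of_int n) - (a * b' + a' * b) * s"
        unfolding * s(1)[symmetric] by (simp_all add: algebra_simps)
      then show ?thesis
        using *(1,2,5,6) by (intro conjI[of "a * a' + b * b' * of_int n" "a * b' + a' * b"]) simp_all
    qed
    show "y = 0" if y: "conj 0 y" for y
    proof -
      obtain a b where "a \<in> \<rat>" "b \<in> \<rat>" "a + b * s = 0" "y = a - b * s"
        using y unfolding conj_def by metis
      then show ?thesis using irrational_lin_indep[OF s(2), of a b] by simp
    qed
    show "conj (u + v * s) (u - v * s)" using uv by (intro conjI[of u v]) auto
    show "algebraic_int (u + v * s)" using int by (simp add: s_def)
  qed
  have int: "algebraic_int (u + v * s)" using int by (simp add: s_def)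
  have "2 * u \<in> \<int>"
    using algebraic_int_add_mult(1)[OF int int'] uv(1)
    by (intro rational_algebraic_int_is_int) simp_all
  then obtain x where x: "2 * u = of_int x" by (elim Ints_cases)
  have "(u + v * s) * (u - v * s) = u\<^sup>2 - of_int n * v\<^sup>2"
    by (simp add: algebra_simps power2_eq_square flip: s(1))
  then have "u\<^sup>2 - of_int n * v\<^sup>2 \<in> \<int>"
    using algebraic_int_add_mult(2)[OF int int'] uv
    by (intro rational_algebraic_int_is_int) simp_all
  then obtain N where N: "u\<^sup>2 - of_int n * v\<^sup>2 = of_int N" by (elim Ints_cases)
  then have "of_int n * (2 * v)\<^sup>2 = (2 * u)\<^sup>2 - of_int (4 * N)" by (simp add: algebra_simps)
  also have "\<dots> \<in> \<int>" unfolding x by simp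
  finally have "2 * v \<in> \<int>"
    by (rule rat_square_times_squarefree_int[OF n(1), rotated]) (simp add: uv)
  then obtain y where y: "2 * v = of_int y" by (elim Ints_cases)
  have "of_int (x\<^sup>2 - n * y\<^sup>2) = (2 * u)\<^sup>2 - of_int n * (2 * v)\<^sup>2" by (simp add: x y)
  also have "\<dots> = of_int (4 * N)" using N by (simp add: algebra_simps)
  finally have "x\<^sup>2 - n * y\<^sup>2 = 4 * N" by (rule of_int_eq_iff[THEN iffD1])
  then have "even (x\<^sup>2 - n * y\<^sup>2)" by simp
  moreover have "odd n" using n(3) by presburger
  ultimately have "even (x - y)" by simp
  moreover have "u = of_int x / 2" "v = of_int y / 2" using x y by simp_all
  ultimately show ?thesis by (intro that)
qed

section \<open>Quadratic integers whose multiples by m are not sums of squares\<close>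

lemma int_above_with_parity:
  obtains a :: int where "even (a - b)" "t < of_int a" "of_int a \<le> t + (2 :: real)"
proof (cases "even (\<lfloor>t\<rfloor> + 1 - b)")
  case True
  moreover have "t < of_int (\<lfloor>t\<rfloor> + 1)" "of_int (\<lfloor>t\<rfloor> + 1) \<le> t + 2" by linarith+
  ultimately show ?thesis by (rule that)
next
  case False
  then have "even (\<lfloor>t\<rfloor> + 2 - b)" by presburger
  moreover have "t < of_int (\<lfloor>t\<rfloor> + 2)" "of_int (\<lfloor>t\<rfloor> + 2) \<le> t + 2" by linarith+
  ultimately show ?thesis by (rule that)
qed

lemma square_mult_le_cancel:
  fixes c y k :: real
  assumes "(c * y)\<^sup>2 \<le> k * y" "y > 0"
  shows "c\<^sup>2 * y \<le> k"
proof -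
  have "(c\<^sup>2 * y) * y \<le> k * y" using assms(1) by (simp add: power_mult_distrib power2_eq_square mult_ac)
  then show ?thesis using assms(2) by (rule mult_right_le_imp_le)
qed

text \<open>U and Y play the roles of \<Sum>x^2 and \<Sum>y^2. Eliminating U confines Y to a short
  interval around m b / \<surd>n, and b is chosen such that the interval contains no integer of the
  required parity.\<close>

lemma not_represented_core:
  fixes m n :: int
  assumes m: "m > 0" and n: "n \<ge> (m + 8)\<^sup>2"
  obtains a b :: int where "even (a - b)" "of_int a > \<bar>of_int b\<bar> * sqrt (of_int n)"
    "\<nexists>U Y. 0 \<le> U \<and> 0 \<le> Y \<and> U + n * Y = 2 * m * a \<and> (m * b)\<^sup>2 \<le> U * Y \<and> even (Y - m * b)"
proof -
  define s where "s = sqrt (of_int n :: real)"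
  define \<mu> where "\<mu> = (of_int m :: real)"
  have \<mu>: "\<mu> \<ge> 1" using m by (simp add: \<mu>_def)
  have ss: "s * s = of_int n"
    using order_trans[OF zero_le_power2 n] by (simp add: s_def)
  have "of_int ((m + 8)\<^sup>2) \<le> (of_int n :: real)" using n by (simp only: of_int_le_iff)
  then have s8: "s \<ge> \<mu> + 8" unfolding s_def \<mu>_def by (intro real_le_rsqrt) simp
  define \<epsilon> where "\<epsilon> = s - \<mu>"
  have \<epsilon>: "\<epsilon> \<ge> 8" "s = \<mu> + \<epsilon>" using s8 by (auto simp: \<epsilon>_def)
  \<comment> \<open>For even m, Y is even and at least 2, which is already too far from m/s. For odd
    m, b is the least integer above 4\<mu>/\<epsilon>^2: this excludes Y \<ge> b, parity excludes Y
    = b - 1, and smaller values of Y are too far from \<mu>b/s on the other side.\<close>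
  define b where "b = (if even m then 1 else \<lfloor>4 * \<mu> / \<epsilon>\<^sup>2\<rfloor> + 1)"
  have "4 * \<mu> / \<epsilon>\<^sup>2 \<ge> 0" using \<mu> by simp
  then have b: "b \<ge> 1" by (simp add: b_def)
  obtain a where a: "even (a - b)" "of_int b * s < of_int a" "of_int a \<le> of_int b * s + 2"
    using int_above_with_parity[of b "of_int b * s"] by blast
  have contra: False if UY: "U \<ge> 0" "Y \<ge> 0" "U + n * Y = 2 * m * a" "(m * b)\<^sup>2 \<le> U * Y"
    "even (Y - m * b)" for U Y
  proof -
    define x y \<beta> where "x = (of_int U :: real)" and "y = (of_int Y :: real)"
      and "\<beta> = (of_int b :: real)"
    have "(m * b)\<^sup>2 > 0" using m b by simp
    with UY(4) have "Y \<noteq> 0" by (metis mult_zero_right not_less)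
    with UY(2) have Y1: "Y \<ge> 1" by simp
    then have y1: "y \<ge> 1" by (simp add: y_def)
    have "x + s * s * y = 2 * \<mu> * of_int a"
      using arg_cong[OF UY(3), of real_of_int] by (simp add: x_def y_def \<mu>_def ss)
    moreover have "\<mu> * of_int a \<le> \<mu> * (\<beta> * s + 2)"
      using a(3) \<mu> by (intro mult_left_mono) (auto simp: \<beta>_def)
    ultimately have "x + s * s * y \<le> 2 * \<mu> * \<beta> * s + 4 * \<mu>" by (simp add: algebra_simps)
    then have "(x + s * s * y) * y \<le> (2 * \<mu> * \<beta> * s + 4 * \<mu>) * y"
      using y1 by (intro mult_right_mono) auto
    moreover have "(\<mu> * \<beta>)\<^sup>2 \<le> x * y"
    proof -
      have "real_of_int ((m * b)\<^sup>2) \<le> of_int (U * Y)" using UY(4) by (simp only: of_int_le_iff)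
      then show ?thesis by (simp add: x_def y_def \<mu>_def \<beta>_def)
    qed
    \<comment> \<open>Completing the square. The error 4\<mu>y comes from \<open>a\<close> exceeding
      b s by at most 2.\<close>
    moreover have "(s * y - \<mu> * \<beta>)\<^sup>2
        = (x + s * s * y) * y - 2 * \<mu> * \<beta> * s * y + ((\<mu> * \<beta>)\<^sup>2 - x * y)"
      by (simp add: power2_eq_square algebra_simps)
    ultimately have key: "(s * y - \<mu> * \<beta>)\<^sup>2 \<le> 4 * \<mu> * y"
      by (simp add: distrib_right)
    show False
    proof (cases "even m")
      case True
      with UY(5) have "even Y" by simp
      with Y1 have "Y \<ge> 2" by presburger
      then have y2: "y \<ge> 2" by (simp add: y_def)
      have \<beta>: "\<beta> = 1" using True by (simp add: \<beta>_def b_def)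
      have "(\<mu> + 8) * y \<le> s * y" using s8 y1 by (intro mult_right_mono) auto
      moreover have "\<mu> * 2 \<le> \<mu> * y" using y2 \<mu> by (intro mult_left_mono) auto
      \<comment> \<open>As y \<ge> 2, the subtracted \<mu> is at most half of \<mu>y. The
        contradiction then follows from (\<mu>/2 + 8)^2 \<ge> 16\<mu>.\<close>
      ultimately have "(\<mu> / 2 + 8) * y \<le> s * y - \<mu> * \<beta>" by (simp add: \<beta> algebra_simps)
      then have "((\<mu> / 2 + 8) * y)\<^sup>2 \<le> (s * y - \<mu> * \<beta>)\<^sup>2"
        using y1 \<mu> by (intro power_mono) simp_all
      with key have "((\<mu> / 2 + 8) * y)\<^sup>2 \<le> 4 * \<mu> * y" by linarith
      then have "(\<mu> / 2 + 8)\<^sup>2 * y \<le> 4 * \<mu>" using y1 by (intro square_mult_le_cancel) auto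
      moreover have "(\<mu> / 2 + 8)\<^sup>2 * 1 \<le> (\<mu> / 2 + 8)\<^sup>2 * y"
        using y1 by (intro mult_left_mono) auto
      moreover have "(\<mu> / 2 + 8)\<^sup>2 = (\<mu> / 2 - 8)\<^sup>2 + 16 * \<mu>"
        by (simp add: power2_eq_square algebra_simps)
      moreover have "(\<mu> / 2 - 8)\<^sup>2 \<ge> 0" by simp
      ultimately show False using \<mu> by linarith
    next
      case False
      have \<beta>: "4 * \<mu> / \<epsilon>\<^sup>2 < \<beta>" "\<beta> \<le> 4 * \<mu> / \<epsilon>\<^sup>2 + 1"
        using False unfolding \<beta>_def b_def by simp_all
      have "Y < b"
      proof (rule ccontr)
        assume "\<not> Y < b"
        then have "\<beta> \<le> y" by (simp add: \<beta>_def y_def)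
        then have "\<mu> * \<beta> \<le> \<mu> * y" using \<mu> by (intro mult_left_mono) auto
        then have "\<epsilon> * y \<le> s * y - \<mu> * \<beta>" by (simp add: \<epsilon>(2) algebra_simps)
        then have "(\<epsilon> * y)\<^sup>2 \<le> (s * y - \<mu> * \<beta>)\<^sup>2"
          using y1 \<epsilon>(1) by (intro power_mono) simp_all
        with key have "(\<epsilon> * y)\<^sup>2 \<le> 4 * \<mu> * y" by linarith
        then have "\<epsilon>\<^sup>2 * y \<le> 4 * \<mu>" using y1 by (intro square_mult_le_cancel) auto
        then have "y \<le> 4 * \<mu> / \<epsilon>\<^sup>2" using \<epsilon>(1) by (subst pos_le_divide_eq) (auto simp: mult.commute)
        with \<open>\<beta> \<le> y\<close> \<beta>(1) show False by simp
      qed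
      moreover have "even (Y - b)" using UY(5) False by auto
      ultimately have "Y \<le> b - 2" by presburger
      then have y: "y \<le> \<beta> - 2" unfolding y_def \<beta>_def by linarith
      have "\<epsilon> * \<beta> \<le> \<epsilon> * (4 * \<mu> / \<epsilon>\<^sup>2 + 1)" using \<beta>(2) \<epsilon>(1) by (intro mult_left_mono) auto
      also have "\<dots> = 4 * \<mu> / \<epsilon> + \<epsilon>" using \<epsilon>(1) by (simp add: distrib_left power2_eq_square)
      finally have \<epsilon>\<beta>': "\<epsilon> * \<beta> \<le> 4 * \<mu> / \<epsilon> + \<epsilon>" .
      \<comment> \<open>Here the 8 in n \<ge> (m + 8)^2 enters: \<epsilon> \<ge> 8 keeps
        \<epsilon>\<beta> below \<mu>/2 + \<epsilon>, although b may be large.\<close>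
      have "4 * \<mu> / \<epsilon> \<le> 4 * \<mu> / 8" using \<epsilon>(1) \<mu> by (intro divide_left_mono) auto
      with \<epsilon>\<beta>' have \<epsilon>\<beta>: "\<epsilon> * \<beta> \<le> \<mu> / 2 + \<epsilon>" by simp
      have "s * y \<le> s * (\<beta> - 2)" using y s8 \<mu> by (intro mult_left_mono) auto
      then have "\<mu> * \<beta> - s * y \<ge> 2 * s - \<epsilon> * \<beta>" by (simp add: \<epsilon>(2) algebra_simps)
      \<comment> \<open>A distance of at least \<mu> forces y \<ge> \<mu>/4 by \<open>key\<close>,
        whereas the choice of b gives y \<le> 4\<mu>/\<epsilon>^2 - 1 \<le> \<mu>/16 - 1.\<close>
      then have "\<mu> * \<beta> - s * y \<ge> \<mu>" using \<epsilon>\<beta> \<epsilon> \<mu> by linarith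
      then have "\<mu>\<^sup>2 \<le> (\<mu> * \<beta> - s * y)\<^sup>2" using \<mu> by (intro power_mono) auto
      also have "\<dots> \<le> 4 * \<mu> * y" using key by (simp add: power2_commute)
      finally have "\<mu> * \<mu> \<le> \<mu> * (4 * y)" by (simp add: power2_eq_square)
      then have "\<mu> \<le> 4 * y" using \<mu> by (subst (asm) mult_le_cancel_left_pos) auto
      moreover have "y \<le> 4 * \<mu> / \<epsilon>\<^sup>2 - 1" using y \<beta>(2) by simp
      moreover have "4 * \<mu> / \<epsilon>\<^sup>2 \<le> 4 * \<mu> / 8\<^sup>2"
        using \<epsilon>(1) \<mu> by (intro divide_left_mono power_mono) auto
      moreover have "4 * \<mu> / 8\<^sup>2 = \<mu> / 16" by simp
      ultimately show False using \<mu> by linarith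
    qed
  qed
  have core: "\<nexists>U Y. 0 \<le> U \<and> 0 \<le> Y \<and> U + n * Y = 2 * m * a \<and> (m * b)\<^sup>2 \<le> U * Y \<and> even (Y - m * b)"
    by (rule notI, elim exE conjE) (rule contra)
  have "of_int a > \<bar>of_int b\<bar> * sqrt (of_int n)" using a(2) b by (simp add: s_def)
  then show ?thesis by (rule that[OF a(1) _ core])
qed

text \<open>The two sums are the coordinates of the equation \<Sum>((x + y\<surd>n)/2)^2 = m(a +
  b\<surd>n)/2. The Cauchy-Schwarz inequality and the congruence y^2 \<equiv> x y (mod 2) reduce it
  to the two integers U = \<Sum>x^2 and Y = \<Sum>y^2.\<close>

lemma not_sum_of_squares_quadratic:
  fixes m n :: int
  assumes "m > 0" "n \<ge> (m + 8)\<^sup>2"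
  obtains a b :: int where "even (a - b)" "of_int a > \<bar>of_int b\<bar> * sqrt (of_int n)"
    "\<nexists>(N::nat) x y. (\<forall>i<N. even (x i - y i)) \<and> (\<Sum>i<N. (x i)\<^sup>2 + n * (y i)\<^sup>2) = 2 * m * a \<and>
      (\<Sum>i<N. x i * y i) = m * b"
proof (rule not_represented_core[OF assms])
  fix a b :: int
  assume ab: "even (a - b)" "of_int a > \<bar>of_int b\<bar> * sqrt (of_int n)"
    and core: "\<nexists>U Y. 0 \<le> U \<and> 0 \<le> Y \<and> U + n * Y = 2 * m * a \<and> (m * b)\<^sup>2 \<le> U * Y \<and> even (Y - m * b)"
  have contra: False if "\<forall>i<N. even (x i - y i)" "(\<Sum>i<N. (x i)\<^sup>2 + n * (y i)\<^sup>2) = 2 * m * a"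
    "(\<Sum>i<N. x i * y i) = m * b" for N :: nat and x y
  proof (rule notE[OF core], intro exI conjI)
    show "(\<Sum>i<N. (x i)\<^sup>2) \<ge> 0" "(\<Sum>i<N. (y i)\<^sup>2) \<ge> 0" by (auto intro: sum_nonneg)
    show "(\<Sum>i<N. (x i)\<^sup>2) + n * (\<Sum>i<N. (y i)\<^sup>2) = 2 * m * a"
      using that(2) by (simp add: sum.distrib sum_distrib_left)
    show "(m * b)\<^sup>2 \<le> (\<Sum>i<N. (x i)\<^sup>2) * (\<Sum>i<N. (y i)\<^sup>2)"
    proof -
      have "(\<Sum>i<N. of_int (x i) * of_int (y i) :: real)\<^sup>2
          \<le> (\<Sum>i<N. (of_int (x i))\<^sup>2) * (\<Sum>i<N. (of_int (y i))\<^sup>2)"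
        by (rule Cauchy_Schwarz_ineq_sum)
      then have "real_of_int ((\<Sum>i<N. x i * y i)\<^sup>2) \<le> of_int ((\<Sum>i<N. (x i)\<^sup>2) * (\<Sum>i<N. (y i)\<^sup>2))"
        by simp
      then show ?thesis by (simp only: of_int_le_iff that(3))
    qed
    have "(\<Sum>i<N. (y i)\<^sup>2) - m * b = - (\<Sum>i<N. (x i - y i) * y i)"
      unfolding that(3)[symmetric]
      by (simp add: algebra_simps power2_eq_square sum_subtractf)
    moreover have "even (\<Sum>i<N. (x i - y i) * y i)"
      using that(1) by (intro dvd_sum) auto
    ultimately show "even ((\<Sum>i<N. (y i)\<^sup>2) - m * b)" by simp
  qed
  show ?thesis by (rule that[OF ab]) (blast intro: contra)
qed

section \<open>Generated subfields of the reals and their embeddings\<close>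

lemma real_ring_simps [simp]:
  "carrier real_ring = UNIV" "x \<otimes>\<^bsub>real_ring\<^esub> y = x * y" "\<one>\<^bsub>real_ring\<^esub> = 1"
  "\<zero>\<^bsub>real_ring\<^esub> = 0" "x \<oplus>\<^bsub>real_ring\<^esub> y = x + y"
  by (simp_all add: ring_of_type_algebra_def)

lemma real_ring_a_inv [simp]: "\<ominus>\<^bsub>real_ring\<^esub> x = - x"
proof -
  interpret Ring.field real_ring by (rule field_from_type_algebra)
  show ?thesis by (rule minus_equality) simp_all
qed

lemma real_ring_m_inv: "x \<noteq> 0 \<Longrightarrow> inv\<^bsub>real_ring\<^esub> x = inverse x"
proof -
  interpret Ring.field real_ring by (rule field_from_type_algebra)
  show "x \<noteq> 0 \<Longrightarrow> inv\<^bsub>real_ring\<^esub> x = inverse x" by (rule comm_inv_char) simp_all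
qed

lemma rat_adjoin_base: "x \<in> S \<Longrightarrow> x \<in> rat_adjoin S"
  unfolding rat_adjoin_def by (rule generate_field.incl)

lemma rat_adjoin_one: "1 \<in> rat_adjoin S"
  unfolding rat_adjoin_def using generate_field.one[of real_ring S] by simp

lemma rat_adjoin_minus: "x \<in> rat_adjoin S \<Longrightarrow> - x \<in> rat_adjoin S"
  unfolding rat_adjoin_def using generate_field.a_inv[of x real_ring S] by simp

lemma rat_adjoin_add: "x \<in> rat_adjoin S \<Longrightarrow> y \<in> rat_adjoin S \<Longrightarrow> x + y \<in> rat_adjoin S"
  unfolding rat_adjoin_def using generate_field.eng_add[of x real_ring S y] by simp

lemma rat_adjoin_mult: "x \<in> rat_adjoin S \<Longrightarrow> y \<in> rat_adjoin S \<Longrightarrow> x * y \<in> rat_adjoin S"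
  unfolding rat_adjoin_def using generate_field.eng_mult[of x real_ring S y] by simp

lemma rat_adjoin_zero: "0 \<in> rat_adjoin S"
  using rat_adjoin_add[OF rat_adjoin_one rat_adjoin_minus[OF rat_adjoin_one]] by simp

text \<open>Field generation inverts nonzero elements only; at 0 the convention
  \<open>inverse 0 = 0\<close> takes over.\<close>

lemma rat_adjoin_inverse: "x \<in> rat_adjoin S \<Longrightarrow> inverse x \<in> rat_adjoin S"
  unfolding rat_adjoin_def
  using generate_field.m_inv[of x real_ring S] rat_adjoin_zero[of S]
  by (cases "x = 0") (simp_all add: rat_adjoin_def real_ring_m_inv)

lemma rat_adjoin_of_nat: "of_nat n \<in> rat_adjoin S"
  by (induction n) (simp_all add: rat_adjoin_zero rat_adjoin_add rat_adjoin_one)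

lemma rat_adjoin_of_int: "of_int k \<in> rat_adjoin S"
  by (cases k rule: int_cases2) (simp_all add: rat_adjoin_of_nat rat_adjoin_minus)

lemma rat_adjoin_Rats: "x \<in> \<rat> \<Longrightarrow> x \<in> rat_adjoin S"
proof -
  assume "x \<in> \<rat>"
  then obtain a b where "x = of_int a * inverse (of_int b)"
    by (elim Rats_cases') (simp add: divide_inverse)
  then show "x \<in> rat_adjoin S"
    by (simp only: rat_adjoin_mult rat_adjoin_inverse rat_adjoin_of_int)
qed

lemma rat_adjoin_induct [consumes 1, case_names one base minus inverse add mult]:
  assumes "x \<in> rat_adjoin S"
    and "P 1" "\<And>x. x \<in> S \<Longrightarrow> P x" "\<And>x. P x \<Longrightarrow> P (- x)"
    "\<And>x. x \<noteq> 0 \<Longrightarrow> P x \<Longrightarrow> P (inverse x)"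
    "\<And>x y. P x \<Longrightarrow> P y \<Longrightarrow> P (x + y)" "\<And>x y. P x \<Longrightarrow> P y \<Longrightarrow> P (x * y)"
  shows "P x"
  using assms(1) unfolding rat_adjoin_def
proof (induction rule: generate_field.induct)
  case (m_inv h)
  then show ?case using assms(5) by (simp add: real_ring_m_inv)
qed (use assms in simp_all)

lemma real_embeddings_hom:
  assumes "\<sigma> \<in> real_embeddings F"
  shows "\<sigma> 1 = 1" "x \<in> F \<Longrightarrow> y \<in> F \<Longrightarrow> \<sigma> (x + y) = \<sigma> x + \<sigma> y"
    "x \<in> F \<Longrightarrow> y \<in> F \<Longrightarrow> \<sigma> (x * y) = \<sigma> x * \<sigma> y"
  using assms ring_hom_one[of \<sigma> "real_ring\<lparr>carrier := F\<rparr>" real_ring]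
    ring_hom_add[of \<sigma> "real_ring\<lparr>carrier := F\<rparr>" real_ring x y]
    ring_hom_mult[of \<sigma> "real_ring\<lparr>carrier := F\<rparr>" real_ring x y]
  unfolding real_embeddings_def by simp_all

text \<open>A unital homomorphism fixes 0 and 1, hence the naturals and the integers; a fraction
  follows by clearing its denominator.\<close>

lemma real_embeddings_Rats:
  assumes \<sigma>: "\<sigma> \<in> real_embeddings (rat_adjoin S)" and "x \<in> \<rat>"
  shows "\<sigma> x = x"
proof -
  note hom = real_embeddings_hom[OF \<sigma>]
  have zero: "\<sigma> 0 = 0" using hom(2)[OF rat_adjoin_zero rat_adjoin_zero] by simp
  have nat: "\<sigma> (of_nat n) = of_nat n" for n
    by (induction n) (simp_all add: zero hom rat_adjoin_one rat_adjoin_of_nat)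
  have int: "\<sigma> (of_int k) = of_int k" for k
  proof (cases k rule: int_cases2)
    case (nonpos n)
    then show ?thesis
      using hom(2)[OF rat_adjoin_of_int[of k] rat_adjoin_of_nat[of n]] by (simp add: zero nat)
  qed (simp add: nat)
  obtain a b where b: "b > 0" and x: "x = of_int a / of_int b"
    using Rats_cases'[OF assms(2)] by metis
  have "x * of_int b = of_int a" using b x by simp
  then have "\<sigma> x * of_int b = of_int a"
    using hom(3)[OF rat_adjoin_Rats[OF assms(2)] rat_adjoin_of_int[of b]] by (simp add: int)
  with \<open>x * of_int b = of_int a\<close> have "\<sigma> x * of_int b = x * of_int b" by simp
  with b show ?thesis by simp
qed

text \<open>Both s and its image are roots of X^2 - s^2, whose coefficients are fixed, so they agree
  up to sign.\<close>

lemma real_embeddings_sqrt: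
  assumes \<sigma>: "\<sigma> \<in> real_embeddings (rat_adjoin S)" and "s \<in> rat_adjoin S" "s\<^sup>2 \<in> \<rat>"
  shows "\<bar>\<sigma> s\<bar> = \<bar>s\<bar>"
proof -
  have "(\<sigma> s)\<^sup>2 = \<sigma> (s\<^sup>2)"
    using real_embeddings_hom(3)[OF \<sigma> assms(2,2)] by (simp add: power2_eq_square)
  also have "\<dots> = s\<^sup>2" by (rule real_embeddings_Rats[OF \<sigma> assms(3)])
  finally show ?thesis by (simp only: power2_eq_iff abs_eq_iff)
qed

lemma real_embeddings_ge:
  assumes \<sigma>: "\<sigma> \<in> real_embeddings (rat_adjoin S)" and "s \<in> rat_adjoin S" "s\<^sup>2 \<in> \<rat>" "b \<in> \<rat>"
  shows "\<sigma> (b * s) \<ge> - (\<bar>b\<bar> * \<bar>s\<bar>)"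
proof -
  have "\<sigma> (b * s) = b * \<sigma> s"
    by (simp add: real_embeddings_hom[OF \<sigma>] real_embeddings_Rats[OF \<sigma>] rat_adjoin_Rats assms)
  then have "\<bar>\<sigma> (b * s)\<bar> = \<bar>b\<bar> * \<bar>s\<bar>" by (simp add: abs_mult real_embeddings_sqrt[OF assms(1-3)])
  then show ?thesis by linarith
qed

text \<open>An embedding can only change the signs of s, t, u, and the rational part dominates for
  every choice of signs. Thus the embeddings need not be classified. Elements with fewer irrational
  terms are covered by zero coefficients.\<close>

lemma tot_pos_integersI:
  assumes "a \<in> \<rat>" "b \<in> \<rat>" "c \<in> \<rat>" "w \<in> \<rat>"
    and s: "s \<in> rat_adjoin S" "s\<^sup>2 \<in> \<rat>"
    and t: "t \<in> rat_adjoin S" "t\<^sup>2 \<in> \<rat>"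
    and u: "u \<in> rat_adjoin S" "u\<^sup>2 \<in> \<rat>"
    and pos: "a > \<bar>b\<bar> * \<bar>s\<bar> + \<bar>c\<bar> * \<bar>t\<bar> + \<bar>w\<bar> * \<bar>u\<bar>"
    and int: "algebraic_int (a + b * s + c * t + w * u)"
  shows "a + b * s + c * t + w * u \<in> tot_pos_integers (rat_adjoin S)"
proof -
  have mem: "a \<in> rat_adjoin S" "b * s \<in> rat_adjoin S" "c * t \<in> rat_adjoin S" "w * u \<in> rat_adjoin S"
    by (simp_all add: rat_adjoin_mult rat_adjoin_Rats assms)
  have "\<sigma> (a + b * s + c * t + w * u) > 0" if \<sigma>: "\<sigma> \<in> real_embeddings (rat_adjoin S)" for \<sigma>
  proof -
    have "\<sigma> (a + b * s + c * t + w * u) = a + \<sigma> (b * s) + \<sigma> (c * t) + \<sigma> (w * u)"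
      by (simp add: real_embeddings_hom[OF \<sigma>] real_embeddings_Rats[OF \<sigma> assms(1)] mem rat_adjoin_add)
    then show ?thesis
      using pos real_embeddings_ge[OF \<sigma> s assms(2)] real_embeddings_ge[OF \<sigma> t assms(3)]
        real_embeddings_ge[OF \<sigma> u assms(4)] by linarith
  qed
  then show ?thesis
    using int mem by (simp add: tot_pos_integers_def ring_of_integers_def rat_adjoin_add)
qed

section \<open>Coordinates in the biquadratic field\<close>

text \<open>Here p = g d, q = g e and r = d e. The assumptions are symmetric in the three
  parameters, so exchanging d and e turns statements about \<rat>(\<surd>p) into statements about
  \<rat>(\<surd>q).\<close>

locale biquad =
  fixes g d e :: int
  assumes pos: "g > 0" "d > 0" "e > 0"
    and sqf: "squarefree (g * d)" "squarefree (g * e)" "squarefree (d * e)"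
    and gt: "g * d > 1" "g * e > 1" "d * e > 1"
    and mod4: "(g * d) mod 4 = 1" "(g * e) mod 4 = 1" "(d * e) mod 4 = 1"
begin

definition sP :: real where "sP = sqrt (of_int (g * d))"
definition sQ :: real where "sQ = sqrt (of_int (g * e))"
definition sR :: real where "sR = sqrt (of_int (d * e))"

text \<open>Coordinates with respect to 1, \<surd>p, \<surd>q, \<surd>r. The coefficients are
  arbitrary reals, so uniqueness is claimed for rational ones only.\<close>

definition lc :: "real \<Rightarrow> real \<Rightarrow> real \<Rightarrow> real \<Rightarrow> real" where
  "lc a b c w = a + b * sP + c * sQ + w * sR"

lemma s_pos: "sP > 0" "sQ > 0" "sR > 0"
  using pos by (simp_all add: sP_def sQ_def sR_def)

lemma s_mult:
  "sP * sP = of_int (g * d)" "sQ * sQ = of_int (g * e)" "sR * sR = of_int (d * e)"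
  "sP * sQ = of_int g * sR" "sP * sR = of_int d * sQ" "sQ * sR = of_int e * sP"
proof -
  define G D E where "G = sqrt (of_int g)" and "D = sqrt (of_int d)" and "E = sqrt (of_int e)"
  have s: "sP = G * D" "sQ = G * E" "sR = D * E"
    by (simp_all add: sP_def sQ_def sR_def real_sqrt_mult G_def D_def E_def)
  have sq: "of_int g = G * G" "of_int d = D * D" "of_int e = E * E"
    using pos by (simp_all add: G_def D_def E_def)
  show "sP * sP = of_int (g * d)" "sQ * sQ = of_int (g * e)" "sR * sR = of_int (d * e)"
    "sP * sQ = of_int g * sR" "sP * sR = of_int d * sQ" "sQ * sR = of_int e * sP"
    unfolding of_int_mult s sq by (simp_all add: mult_ac)
qed

lemma lc_add: "lc a b c w + lc a' b' c' w' = lc (a + a') (b + b') (c + c') (w + w')"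
  by (simp add: lc_def algebra_simps)

lemma lc_mult:
  "lc a b c w * lc a' b' c' w' =
    lc (a * a' + of_int (g * d) * b * b' + of_int (g * e) * c * c' + of_int (d * e) * w * w')
      (a * b' + b * a' + of_int e * (c * w' + w * c'))
      (a * c' + c * a' + of_int d * (b * w' + w * b'))
      (a * w' + w * a' + of_int g * (b * c' + c * b'))"
proof -
  have "lc a b c w * lc a' b' c' w' =
    a * a' + b * b' * (sP * sP) + c * c' * (sQ * sQ) + w * w' * (sR * sR)
    + (a * b' + b * a') * sP + (a * c' + c * a') * sQ + (a * w' + w * a') * sR
    + (b * c' + c * b') * (sP * sQ) + (b * w' + w * b') * (sP * sR) + (c * w' + w * c') * (sQ * sR)"
    unfolding lc_def by (simp add: algebra_simps)
  also have "\<dots> = lc (a * a' + of_int (g * d) * b * b' + of_int (g * e) * c * c' + of_int (d * e) * w * w')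
      (a * b' + b * a' + of_int e * (c * w' + w * c'))
      (a * c' + c * a' + of_int d * (b * w' + w * b'))
      (a * w' + w * a' + of_int g * (b * c' + c * b'))"
    unfolding s_mult lc_def by (simp add: algebra_simps)
  finally show ?thesis .
qed

lemma s_irrational: "sP \<notin> \<rat>" "sQ \<notin> \<rat>" "sR \<notin> \<rat>"
  unfolding sP_def sQ_def sR_def using sqf gt by (auto dest!: sqrt_squarefree_irrational)

text \<open>Moving two of the four terms to the other side and squaring leaves a relation in one
  quadratic field, whose rational part vanishes. The three ways to pair the terms give
  \<open>P\<close>, \<open>Q\<close>, \<open>R\<close>, and their pairwise sums give a^2 = w^2 r =
  c^2 q = b^2 p.\<close>

lemma lin_indep:
  assumes "a \<in> \<rat>" "b \<in> \<rat>" "c \<in> \<rat>" "w \<in> \<rat>" and zero: "lc a b c w = 0"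
  shows "a = 0" "b = 0" "c = 0" "w = 0"
proof -
  have eq: "lc a b 0 0 = - lc 0 0 c w" "lc a 0 c 0 = - lc 0 b 0 w" "lc a 0 0 w = - lc 0 b c 0"
    using zero unfolding lc_def by simp_all
  have "(a\<^sup>2 + b\<^sup>2 * of_int (g * d) - c\<^sup>2 * of_int (g * e) - w\<^sup>2 * of_int (d * e))
      + (2 * a * b - 2 * c * w * of_int e) * sP
    = lc a b 0 0 * lc a b 0 0 - lc 0 0 c w * lc 0 0 c w"
    unfolding lc_mult by (simp add: lc_def power2_eq_square algebra_simps)
  also have "\<dots> = 0" unfolding eq(1) by simp
  finally have P0: "(a\<^sup>2 + b\<^sup>2 * of_int (g * d) - c\<^sup>2 * of_int (g * e) - w\<^sup>2 * of_int (d * e))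
      + (2 * a * b - 2 * c * w * of_int e) * sP = 0" .
  have P: "a\<^sup>2 + b\<^sup>2 * of_int (g * d) - c\<^sup>2 * of_int (g * e) - w\<^sup>2 * of_int (d * e) = 0"
    by (rule irrational_lin_indep(1)[OF s_irrational(1) _ _ P0]) (use assms in simp_all)
  have "(a\<^sup>2 + c\<^sup>2 * of_int (g * e) - b\<^sup>2 * of_int (g * d) - w\<^sup>2 * of_int (d * e))
      + (2 * a * c - 2 * b * w * of_int d) * sQ
    = lc a 0 c 0 * lc a 0 c 0 - lc 0 b 0 w * lc 0 b 0 w"
    unfolding lc_mult by (simp add: lc_def power2_eq_square algebra_simps)
  also have "\<dots> = 0" unfolding eq(2) by simp
  finally have Q0: "(a\<^sup>2 + c\<^sup>2 * of_int (g * e) - b\<^sup>2 * of_int (g * d) - w\<^sup>2 * of_int (d * e))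
      + (2 * a * c - 2 * b * w * of_int d) * sQ = 0" .
  have Q: "a\<^sup>2 + c\<^sup>2 * of_int (g * e) - b\<^sup>2 * of_int (g * d) - w\<^sup>2 * of_int (d * e) = 0"
    by (rule irrational_lin_indep(1)[OF s_irrational(2) _ _ Q0]) (use assms in simp_all)
  have "(a\<^sup>2 + w\<^sup>2 * of_int (d * e) - b\<^sup>2 * of_int (g * d) - c\<^sup>2 * of_int (g * e))
      + (2 * a * w - 2 * b * c * of_int g) * sR
    = lc a 0 0 w * lc a 0 0 w - lc 0 b c 0 * lc 0 b c 0"
    unfolding lc_mult by (simp add: lc_def power2_eq_square algebra_simps)
  also have "\<dots> = 0" unfolding eq(3) by simp
  finally have R0: "(a\<^sup>2 + w\<^sup>2 * of_int (d * e) - b\<^sup>2 * of_int (g * d) - c\<^sup>2 * of_int (g * e))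
      + (2 * a * w - 2 * b * c * of_int g) * sR = 0" .
  have R: "a\<^sup>2 + w\<^sup>2 * of_int (d * e) - b\<^sup>2 * of_int (g * d) - c\<^sup>2 * of_int (g * e) = 0"
    by (rule irrational_lin_indep(1)[OF s_irrational(3) _ _ R0]) (use assms in simp_all)
  have a: "(a + w * sR) * (a - w * sR) = 0" "(a + c * sQ) * (a - c * sQ) = 0"
    "(a + b * sP) * (a - b * sP) = 0"
  proof -
    have prod: "(u + v * t) * (u - v * t) = u\<^sup>2 - v\<^sup>2 * (t * t)" for u v t :: real
      by (simp add: power2_eq_square algebra_simps)
    show "(a + w * sR) * (a - w * sR) = 0" "(a + c * sQ) * (a - c * sQ) = 0"
      "(a + b * sP) * (a - b * sP) = 0"
      unfolding prod s_mult using P Q R by linarith+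
  qed
  from a(1) have "a + w * sR = 0 \<or> a + (- w) * sR = 0" by simp
  then show aw: "a = 0" "w = 0"
    using irrational_lin_indep[OF s_irrational(3), of a w]
      irrational_lin_indep[OF s_irrational(3), of a "- w"] assms(1,4) by auto
  from a(2) aw show "c = 0" using s_pos by simp
  from a(3) aw show "b = 0" using s_pos by simp
qed

lemma lc_eq_iff:
  assumes "a \<in> \<rat>" "b \<in> \<rat>" "c \<in> \<rat>" "w \<in> \<rat>" "a' \<in> \<rat>" "b' \<in> \<rat>" "c' \<in> \<rat>" "w' \<in> \<rat>"
  shows "lc a b c w = lc a' b' c' w' \<longleftrightarrow> a = a' \<and> b = b' \<and> c = c' \<and> w = w'"
proof
  assume "lc a b c w = lc a' b' c' w'"
  then have "lc (a - a') (b - b') (c - c') (w - w') = 0" by (simp add: lc_def algebra_simps)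
  with lin_indep[of "a - a'" "b - b'" "c - c'" "w - w'"] assms
  show "a = a' \<and> b = b' \<and> c = c' \<and> w = w'" by simp
qed simp

text \<open>For signs \<epsilon> and \<delta>, this is the graph of the automorphism of K that sends
  \<surd>p to \<epsilon>\<surd>p and \<surd>q to \<delta>\<surd>q, and therefore \<surd>r to
  \<epsilon>\<delta>\<surd>r.\<close>

definition conj :: "real \<Rightarrow> real \<Rightarrow> real \<Rightarrow> real \<Rightarrow> bool" where
  "conj \<epsilon> \<delta> x y \<longleftrightarrow> (\<exists>a\<in>\<rat>. \<exists>b\<in>\<rat>. \<exists>c\<in>\<rat>. \<exists>w\<in>\<rat>. x = lc a b c w \<and> y = lc a (\<epsilon> * b) (\<delta> * c) (\<epsilon> * \<delta> * w))"

lemma conjI: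
  assumes "a \<in> \<rat>" "b \<in> \<rat>" "c \<in> \<rat>" "w \<in> \<rat>" "x = lc a b c w" "y = lc a (\<epsilon> * b) (\<delta> * c) (\<epsilon> * \<delta> * w)"
  shows "conj \<epsilon> \<delta> x y"
  using assms unfolding conj_def by blast

lemma conjE:
  assumes "conj \<epsilon> \<delta> x y"
  obtains a b c w where "a \<in> \<rat>" "b \<in> \<rat>" "c \<in> \<rat>" "w \<in> \<rat>" "x = lc a b c w"
    "y = lc a (\<epsilon> * b) (\<delta> * c) (\<epsilon> * \<delta> * w)"
  using assms unfolding conj_def by blast

lemma algebraic_int_lc_conj:
  assumes \<epsilon>: "\<epsilon> * \<epsilon> = 1" and \<delta>: "\<delta> * \<delta> = 1"
    and rat: "a \<in> \<rat>" "b \<in> \<rat>" "c \<in> \<rat>" "w \<in> \<rat>" and "algebraic_int (lc a b c w)"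
  shows "algebraic_int (lc a (\<epsilon> * b) (\<delta> * c) (\<epsilon> * \<delta> * w))"
proof -
  have sign: "\<epsilon> = 1 \<or> \<epsilon> = - 1" "\<delta> = 1 \<or> \<delta> = - 1"
    using \<epsilon> \<delta> by (simp_all add: square_eq_1_iff)
  show ?thesis
  proof (rule algebraic_int_conjugate[where conj = "conj \<epsilon> \<delta>"])
    show "conj \<epsilon> \<delta> (of_int k) (of_int k)" for k
      by (rule conjI[of "of_int k" 0 0 0]) (simp_all add: lc_def)
    show "conj \<epsilon> \<delta> (x + x') (y + y')" if xy: "conj \<epsilon> \<delta> x y" "conj \<epsilon> \<delta> x' y'" for x y x' y'
    proof -
      from xy(1) obtain a b c w where 1: "a \<in> \<rat>" "b \<in> \<rat>" "c \<in> \<rat>" "w \<in> \<rat>" "x = lc a b c w"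
        "y = lc a (\<epsilon> * b) (\<delta> * c) (\<epsilon> * \<delta> * w)" by (rule conjE)
      from xy(2) obtain a' b' c' w' where 2: "a' \<in> \<rat>" "b' \<in> \<rat>" "c' \<in> \<rat>" "w' \<in> \<rat>" "x' = lc a' b' c' w'"
        "y' = lc a' (\<epsilon> * b') (\<delta> * c') (\<epsilon> * \<delta> * w')" by (rule conjE)
      show ?thesis
        by (rule conjI[of "a + a'" "b + b'" "c + c'" "w + w'"])
          (use 1(1-4) 2(1-4) in \<open>simp_all add: 1(5,6) 2(5,6) lc_add distrib_left\<close>)
    qed
    show "conj \<epsilon> \<delta> (x * x') (y * y')" if xy: "conj \<epsilon> \<delta> x y" "conj \<epsilon> \<delta> x' y'" for x y x' y'
    proof -
      from xy(1) obtain a b c w where 1: "a \<in> \<rat>" "b \<in> \<rat>" "c \<in> \<rat>" "w \<in> \<rat>" "x = lc a b c w"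
        "y = lc a (\<epsilon> * b) (\<delta> * c) (\<epsilon> * \<delta> * w)" by (rule conjE)
      from xy(2) obtain a' b' c' w' where 2: "a' \<in> \<rat>" "b' \<in> \<rat>" "c' \<in> \<rat>" "w' \<in> \<rat>" "x' = lc a' b' c' w'"
        "y' = lc a' (\<epsilon> * b') (\<delta> * c') (\<epsilon> * \<delta> * w')" by (rule conjE)
      show ?thesis
      proof (rule conjI)
        show "x * x' = lc (a * a' + of_int (g * d) * b * b' + of_int (g * e) * c * c' + of_int (d * e) * w * w')
          (a * b' + b * a' + of_int e * (c * w' + w * c'))
          (a * c' + c * a' + of_int d * (b * w' + w * b'))
          (a * w' + w * a' + of_int g * (b * c' + c * b'))"
          unfolding 1 2 by (rule lc_mult)
        show "y * y' = lc (a * a' + of_int (g * d) * b * b' + of_int (g * e) * c * c' + of_int (d * e) * w * w')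
          (\<epsilon> * (a * b' + b * a' + of_int e * (c * w' + w * c')))
          (\<delta> * (a * c' + c * a' + of_int d * (b * w' + w * b')))
          (\<epsilon> * \<delta> * (a * w' + w * a' + of_int g * (b * c' + c * b')))"
          using sign unfolding 1 2 lc_mult by (elim disjE) (simp_all add: algebra_simps)
      qed (use 1(1-4) 2(1-4) in simp_all)
    qed
    show "y = 0" if y: "conj \<epsilon> \<delta> 0 y" for y
    proof -
      from y obtain a b c w where *: "a \<in> \<rat>" "b \<in> \<rat>" "c \<in> \<rat>" "w \<in> \<rat>" "0 = lc a b c w"
        "y = lc a (\<epsilon> * b) (\<delta> * c) (\<epsilon> * \<delta> * w)" by (rule conjE)
      show ?thesis using lin_indep[OF *(1-4) *(5)[symmetric]] *(6) by (simp add: lc_def)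
    qed
    show "conj \<epsilon> \<delta> (lc a b c w) (lc a (\<epsilon> * b) (\<delta> * c) (\<epsilon> * \<delta> * w))"
      by (rule conjI[OF rat]) simp_all
    show "algebraic_int (lc a b c w)" by fact
  qed
qed

text \<open>The relative traces to the three quadratic subfields are quadratic integers, which
  bounds the denominators by 4. The last clause holds because an element with z = t = 0 already lies
  in \<rat>(\<surd>p), where the denominator 2 suffices.\<close>

lemma algebraic_int_lc_coords:
  assumes rat: "a \<in> \<rat>" "b \<in> \<rat>" "c \<in> \<rat>" "w \<in> \<rat>" and int: "algebraic_int (lc a b c w)"
  obtains x y z t :: int where "lc a b c w = lc (of_int x) (of_int y) (of_int z) (of_int t) / 4"
    "even (x - y)" "even (x - z)" "even (x - t)" "z = 0 \<Longrightarrow> t = 0 \<Longrightarrow> 4 dvd x - y"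
proof -
  note conj = algebraic_int_lc_conj[OF _ _ rat int]
  \<comment> \<open>The signs (1, -1) fix \<surd>p and negate \<surd>q and \<surd>r, so adding this
    conjugate gives the trace to \<rat>(\<surd>p).\<close>
  have "algebraic_int (2 * a + 2 * b * sP)"
    using algebraic_int_add_mult(1)[OF int conj[of 1 "-1"]] by (simp add: lc_def mult.assoc)
  then obtain x y where xy: "2 * a = of_int x / 2" "2 * b = of_int y / 2" "even (x - y)"
    using algebraic_int_quadratic_coeffs[OF sqf(1) gt(1) mod4(1), of "2 * a" "2 * b"] rat
    by (auto simp: sP_def)
  have "algebraic_int (2 * a + 2 * c * sQ)"
    using algebraic_int_add_mult(1)[OF int conj[of "-1" 1]] by (simp add: lc_def mult.assoc)
  then obtain x' z where z: "2 * a = of_int x' / 2" "2 * c = of_int z / 2" "even (x' - z)"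
    using algebraic_int_quadratic_coeffs[OF sqf(2) gt(2) mod4(2), of "2 * a" "2 * c"] rat
    by (auto simp: sQ_def)
  have "algebraic_int (2 * a + 2 * w * sR)"
    using algebraic_int_add_mult(1)[OF int conj[of "-1" "-1"]] by (simp add: lc_def mult.assoc)
  then obtain x'' t where t: "2 * a = of_int x'' / 2" "2 * w = of_int t / 2" "even (x'' - t)"
    using algebraic_int_quadratic_coeffs[OF sqf(3) gt(3) mod4(3), of "2 * a" "2 * w"] rat
    by (auto simp: sR_def)
  \<comment> \<open>All three are 4a, so the parities of y, z and t are compared with the same
    integer.\<close>
  have "x' = x" "x'' = x" using xy(1) z(1) t(1) by simp_all
  have "4 dvd x - y" if "z = 0" "t = 0"
  proof -
    have "algebraic_int (a + b * sP)" using int z(2) t(2) that by (simp add: lc_def)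
    then obtain u v where "a = of_int u / 2" "b = of_int v / 2" "even (u - v)"
      using algebraic_int_quadratic_coeffs[OF sqf(1) gt(1) mod4(1), of a b] rat
      by (auto simp: sP_def)
    with xy(1,2) have "x = 2 * u" "y = 2 * v" by simp_all
    with \<open>even (u - v)\<close> show ?thesis by presburger
  qed

  moreover have "lc a b c w = lc (of_int x) (of_int y) (of_int z) (of_int t) / 4"
  proof -
    have *: "of_int x = 4 * a" "of_int y = 4 * b" "of_int z = 4 * c" "of_int t = 4 * w"
      using xy(1,2) z(2) t(2) by simp_all
    show ?thesis unfolding * lc_def by (simp add: algebra_simps)
  qed
  moreover have "even (x - z)" "even (x - t)"
    using z(3) t(3) \<open>x' = x\<close> \<open>x'' = x\<close> by simp_all
  ultimately show ?thesis using xy(3) that by blast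
qed

abbreviation K :: "real set" where "K \<equiv> rat_adjoin {sP, sQ}"

lemma lc_bex:
  assumes "a \<in> \<rat>" "b \<in> \<rat>" "c \<in> \<rat>" "w \<in> \<rat>"
  shows "\<exists>a'\<in>\<rat>. \<exists>b'\<in>\<rat>. \<exists>c'\<in>\<rat>. \<exists>w'\<in>\<rat>. lc a b c w = lc a' b' c' w'"
  using assms by blast

text \<open>The rational combinations contain the generators and are closed under the field
  operations. Only the inverse takes work: two conjugations make the denominator rational.\<close>

lemma K_coords:
  assumes "x \<in> K"
  shows "\<exists>a\<in>\<rat>. \<exists>b\<in>\<rat>. \<exists>c\<in>\<rat>. \<exists>w\<in>\<rat>. x = lc a b c w"
  using assms
proof (induction rule: rat_adjoin_induct)
  case one
  show ?case by (rule bexI[of _ 1], rule bexI[of _ 0], rule bexI[of _ 0], rule bexI[of _ 0]) (simp_all add: lc_def)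
next
  case (base x)
  then consider "x = lc 0 1 0 0" | "x = lc 0 0 1 0" by (auto simp: lc_def)
  then show ?case by cases (metis Rats_0 Rats_1)+
next
  case (minus x)
  then obtain a b c w where *: "a \<in> \<rat>" "b \<in> \<rat>" "c \<in> \<rat>" "w \<in> \<rat>" "x = lc a b c w" by blast
  then have "- x = lc (- a) (- b) (- c) (- w)" by (simp add: lc_def)
  with *(1-4) show ?case by (metis Rats_minus_iff)
next
  case (inverse x)
  then obtain a b c w where *: "a \<in> \<rat>" "b \<in> \<rat>" "c \<in> \<rat>" "w \<in> \<rat>" "x = lc a b c w" by blast
  \<comment> \<open>\<open>A + B * sP\<close> is the relative norm of x over \<rat>(\<surd>p), the
    product with the conjugate x'; \<open>N\<close> is the norm of that down to \<rat>.\<close>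
  define A B where "A = a\<^sup>2 + b\<^sup>2 * of_int (g * d) - c\<^sup>2 * of_int (g * e) - w\<^sup>2 * of_int (d * e)"
    and "B = 2 * a * b - 2 * c * w * of_int e"
  define N where "N = A\<^sup>2 - B\<^sup>2 * of_int (g * d)"
  have AB: "A \<in> \<rat>" "B \<in> \<rat>" "N \<in> \<rat>" using * by (simp_all add: A_def B_def N_def)
  define x' where "x' = lc a b (- c) (- w)"
  have "x' \<noteq> 0"
  proof
    assume "x' = 0"
    then have "a = 0" "b = 0" "c = 0" "w = 0"
      using lin_indep[of a b "- c" "- w"] * unfolding x'_def by simp_all
    with \<open>x \<noteq> 0\<close> *(5) show False by (simp add: lc_def)
  qed
  have xx': "x * x' = A + B * sP"
    unfolding *(5) x'_def lc_mult by (simp add: A_def B_def lc_def power2_eq_square algebra_simps)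
  have "A - B * sP \<noteq> 0"
  proof
    assume "A - B * sP = 0"
    then have "A = 0" "B = 0" using irrational_lin_indep[OF s_irrational(1), of A "- B"] AB by simp_all
    with xx' \<open>x \<noteq> 0\<close> \<open>x' \<noteq> 0\<close> show False by simp
  qed
  have N: "x * (x' * (A - B * sP)) = N"
  proof -
    have "x * (x' * (A - B * sP)) = (A + B * sP) * (A - B * sP)"
      unfolding xx'[symmetric] by (simp add: mult.assoc)
    also have "\<dots> = A\<^sup>2 - B\<^sup>2 * (sP * sP)" by (simp add: power2_eq_square algebra_simps)
    finally show ?thesis by (simp only: s_mult(1) N_def)
  qed
  have "N \<noteq> 0" using \<open>x \<noteq> 0\<close> \<open>x' \<noteq> 0\<close> \<open>A - B * sP \<noteq> 0\<close> N by (metis mult_eq_0_iff)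
  with N have "inverse x = x' * (A - B * sP) / N"
    using \<open>x \<noteq> 0\<close> by (simp add: divide_eq_eq eq_divide_eq inverse_eq_divide mult.commute)
  also have "x' * (A - B * sP) = lc a b (- c) (- w) * lc A (- B) 0 0" by (simp add: x'_def lc_def)
  finally have "inverse x = lc (1 / N) 0 0 0 * (lc a b (- c) (- w) * lc A (- B) 0 0)"
    by (simp add: lc_def)
  then show ?case unfolding lc_mult by (elim ssubst, intro lc_bex) (use * AB in simp_all)
next
  case (add x y)
  then obtain a b c w a' b' c' w' where *: "a \<in> \<rat>" "b \<in> \<rat>" "c \<in> \<rat>" "w \<in> \<rat>" "x = lc a b c w"
    "a' \<in> \<rat>" "b' \<in> \<rat>" "c' \<in> \<rat>" "w' \<in> \<rat>" "y = lc a' b' c' w'" by blast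
  show ?case unfolding *(5,10) lc_add using * by (intro lc_bex) simp_all
next
  case (mult x y)
  then obtain a b c w a' b' c' w' where *: "a \<in> \<rat>" "b \<in> \<rat>" "c \<in> \<rat>" "w \<in> \<rat>" "x = lc a b c w"
    "a' \<in> \<rat>" "b' \<in> \<rat>" "c' \<in> \<rat>" "w' \<in> \<rat>" "y = lc a' b' c' w'" by blast
  show ?case unfolding *(5,10) lc_mult using * by (intro lc_bex) simp_all
qed

end

section \<open>Sums of squares in coordinates\<close>

text \<open>For n = 4k + 1, (1 + \<surd>n)/2 is a root of X^2 - X - k, and the given element is j +
  b(1 + \<surd>n)/2 with a - b = 2j.\<close>

lemma algebraic_int_half_integers:
  fixes n a b :: int
  assumes "n > 0" "n mod 4 = 1" "even (a - b)"
  shows "algebraic_int ((of_int a + of_int b * sqrt (of_int n)) / 2 :: real)"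
proof -
  define s where "s = sqrt (of_int n :: real)"
  have s: "s * s = of_int n" using assms(1) by (simp add: s_def)
  obtain k where k: "n = 4 * k + 1" using assms(2) by (metis mult_div_mod_eq)
  have "poly (map_poly of_int [:- k, - 1, 1:]) ((1 + s) / 2) = 0"
    using s by (simp add: map_poly_pCons k field_simps)
  then have half: "algebraic_int ((1 + s) / 2)"
    unfolding algebraic_int_altdef_ipoly by (intro exI[of _ "[:- k, - 1, 1:]"] conjI) simp_all
  obtain j where j: "a - b = 2 * j" using assms(3) by (elim evenE)
  have "algebraic_int (of_int j + of_int b * ((1 + s) / 2))"
    by (intro algebraic_int_add_mult half int_imp_algebraic_int) simp_all
  moreover have "of_int j + of_int b * ((1 + s) / 2) = (of_int a + of_int b * s) / 2"
  proof -
    have "real_of_int a = of_int b + 2 * of_int j" using arg_cong[OF j, of real_of_int] by simp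
    then show ?thesis by (simp add: field_simps)
  qed
  ultimately show ?thesis by (simp only: s_def)
qed

lemma sum_append_lessThan:
  "(\<Sum>i<N + M. if i < N then f i else h (i - N)) = (\<Sum>i<N. f i) + (\<Sum>i<(M::nat). h i :: int)"
  by (induction M) simp_all

text \<open>Integer coding of the statement that (A + 2B\<surd>n)/4 is a sum of squares of elements
  (x + y\<surd>n)/2 with x \<equiv> y (mod 2).\<close>

definition quad_sum_of_squares :: "int \<Rightarrow> int \<Rightarrow> int \<Rightarrow> bool" where
  "quad_sum_of_squares n A B \<longleftrightarrow> (\<exists>(N::nat) x y. (\<forall>i<N. even (x i - y i)) \<and>
    (\<Sum>i<N. (x i)\<^sup>2 + n * (y i)\<^sup>2) = A \<and> (\<Sum>i<N. x i * y i) = B)"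

lemma quad_sum_of_squares_add:
  assumes "quad_sum_of_squares n A B" "quad_sum_of_squares n A' B'"
  shows "quad_sum_of_squares n (A + A') (B + B')"
proof -
  from assms(1) obtain N :: nat and x y where N: "(\<forall>i<N. even (x i - y i)) \<and>
    (\<Sum>i<N. (x i)\<^sup>2 + n * (y i)\<^sup>2) = A \<and> (\<Sum>i<N. x i * y i) = B"
    unfolding quad_sum_of_squares_def by (elim exE)
  then have 1: "\<forall>i<N. even (x i - y i)" "(\<Sum>i<N. (x i)\<^sup>2 + n * (y i)\<^sup>2) = A" "(\<Sum>i<N. x i * y i) = B"
    by simp_all
  from assms(2) obtain N' :: nat and x' y' where N': "(\<forall>i<N'. even (x' i - y' i)) \<and>
    (\<Sum>i<N'. (x' i)\<^sup>2 + n * (y' i)\<^sup>2) = A' \<and> (\<Sum>i<N'. x' i * y' i) = B'"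
    unfolding quad_sum_of_squares_def by (elim exE)
  then have 2: "\<forall>i<N'. even (x' i - y' i)" "(\<Sum>i<N'. (x' i)\<^sup>2 + n * (y' i)\<^sup>2) = A'"
    "(\<Sum>i<N'. x' i * y' i) = B'"
    by simp_all
  define u v where "u i = (if i < N then x i else x' (i - N))"
    and "v i = (if i < N then y i else y' (i - N))" for i
  have "(\<Sum>i<N + N'. (u i)\<^sup>2 + n * (v i)\<^sup>2) = (\<Sum>i<N + N'. if i < N then (x i)\<^sup>2 + n * (y i)\<^sup>2
      else (x' (i - N))\<^sup>2 + n * (y' (i - N))\<^sup>2)"
    by (rule sum.cong) (simp_all add: u_def v_def)
  also have "\<dots> = A + A'"
    unfolding sum_append_lessThan[where h = "\<lambda>i. (x' i)\<^sup>2 + n * (y' i)\<^sup>2"] 1 2 ..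
  finally have A: "(\<Sum>i<N + N'. (u i)\<^sup>2 + n * (v i)\<^sup>2) = A + A'" .
  have "(\<Sum>i<N + N'. u i * v i) = (\<Sum>i<N + N'. if i < N then x i * y i else x' (i - N) * y' (i - N))"
    by (rule sum.cong) (simp_all add: u_def v_def)
  also have "\<dots> = B + B'"
    unfolding sum_append_lessThan[where h = "\<lambda>i. x' i * y' i"] 1 2 ..
  finally have B: "(\<Sum>i<N + N'. u i * v i) = B + B'" .
  have "\<forall>i<N + N'. even (u i - v i)"
  proof (intro allI impI)
    fix i assume "i < N + N'"
    then show "even (u i - v i)"
      using 1(1)[rule_format, of i] 2(1)[rule_format, of "i - N"] by (simp add: u_def v_def)
  qed
  with A B show ?thesis unfolding quad_sum_of_squares_def by blast
qed

context biquad
begin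

lemma lc_sum:
  "(\<Sum>i<(N::nat). lc (a i) (b i) (c i) (w i)) = lc (\<Sum>i<N. a i) (\<Sum>i<N. b i) (\<Sum>i<N. c i) (\<Sum>i<N. w i)"
  by (simp add: lc_def sum.distrib sum_distrib_right)

lemma lc_square:
  "(lc a b c w)\<^sup>2 = lc (a\<^sup>2 + of_int (g * d) * b\<^sup>2 + of_int (g * e) * c\<^sup>2 + of_int (d * e) * w\<^sup>2)
    (2 * (a * b) + 2 * of_int e * (c * w)) (2 * (a * c) + 2 * of_int d * (b * w))
    (2 * (a * w) + 2 * of_int g * (b * c))"
proof -
  have double: "u * v + v * u = 2 * (u * v)" for u v :: real by simp
  show ?thesis unfolding power2_eq_square lc_mult double by (simp only: mult_ac)
qed

text \<open>Necessary conditions for (x + y\<surd>p + z\<surd>q + t\<surd>r)/4 to be integral; they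
  do not characterise integrality.\<close>

definition integral_quad :: "int \<Rightarrow> int \<Rightarrow> int \<Rightarrow> int \<Rightarrow> bool" where
  "integral_quad x y z t \<longleftrightarrow> even (x - y) \<and> even (x - z) \<and> even (x - t) \<and>
    (z = 0 \<longrightarrow> t = 0 \<longrightarrow> 4 dvd x - y)"

lemma ring_of_integers_K_coords:
  assumes "v \<in> ring_of_integers K"
  shows "\<exists>x y z t. integral_quad x y z t \<and> v = lc (of_int x) (of_int y) (of_int z) (of_int t) / 4"
proof -
  have v: "v \<in> K" "algebraic_int v" using assms by (simp_all add: ring_of_integers_def)
  from K_coords[OF v(1)] obtain a b c w where rat: "a \<in> \<rat>" "b \<in> \<rat>" "c \<in> \<rat>" "w \<in> \<rat>"
    and eq: "v = lc a b c w" by blast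
  show ?thesis unfolding eq
    by (rule algebraic_int_lc_coords[OF rat v(2)[unfolded eq]])
      (unfold integral_quad_def, blast)
qed

text \<open>Squaring turns the denominator 4 into 16, whence the factor 4 on the right. Only the
  coordinates at 1 and \<surd>p are recorded; the trace bound and the descent work with these
  two.\<close>

lemma sums_of_squares_coords:
  assumes "lc (of_int A) (of_int B) (of_int C) (of_int W) / 4 \<in> sums_of_squares (ring_of_integers K)"
  obtains N :: nat and x y z t where
    "\<And>i. i < N \<Longrightarrow> integral_quad (x i) (y i) (z i) (t i)"
    "(\<Sum>i<N. (x i)\<^sup>2 + g * d * (y i)\<^sup>2 + g * e * (z i)\<^sup>2 + d * e * (t i)\<^sup>2) = 4 * A"
    "(\<Sum>i<N. 2 * (x i * y i) + 2 * e * (z i * t i)) = 4 * B"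
proof -
  from assms obtain N f where f: "\<forall>i<N. f i \<in> ring_of_integers K"
    and sum: "lc (of_int A) (of_int B) (of_int C) (of_int W) / 4 = (\<Sum>i<(N::nat). (f i)\<^sup>2)"
    unfolding sums_of_squares_def by blast
  have "\<forall>i. \<exists>p. i < N \<longrightarrow> (case p of (x, y, z, t) \<Rightarrow> integral_quad x y z t \<and>
      f i = lc (of_int x) (of_int y) (of_int z) (of_int t) / 4)"
    using ring_of_integers_K_coords f by simp
  from choice[OF this] obtain p where p: "\<forall>i. i < N \<longrightarrow> (case p i of (x, y, z, t) \<Rightarrow>
      integral_quad x y z t \<and> f i = lc (of_int x) (of_int y) (of_int z) (of_int t) / 4)" by (elim exE)
  define x y z t where "x i = fst (p i)" and "y i = fst (snd (p i))" and "z i = fst (snd (snd (p i)))"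
    and "t i = snd (snd (snd (p i)))" for i
  have xyzt: "integral_quad (x i) (y i) (z i) (t i)"
    "f i = lc (of_int (x i)) (of_int (y i)) (of_int (z i)) (of_int (t i)) / 4" if "i < N" for i
    using p[rule_format, OF that] by (simp_all add: x_def y_def z_def t_def case_prod_beta)
  define a b c w where "a i = (x i)\<^sup>2 + g * d * (y i)\<^sup>2 + g * e * (z i)\<^sup>2 + d * e * (t i)\<^sup>2"
    and "b i = 2 * (x i * y i) + 2 * e * (z i * t i)"
    and "c i = 2 * (x i * z i) + 2 * d * (y i * t i)"
    and "w i = 2 * (x i * t i) + 2 * g * (y i * z i)" for i
  have sq: "(f i)\<^sup>2 = lc (of_int (a i)) (of_int (b i)) (of_int (c i)) (of_int (w i)) / 16" if "i < N" for i
    unfolding xyzt(2)[OF that] power_divide lc_square a_def b_def c_def w_def by simp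
  have "(\<Sum>i<N. (f i)\<^sup>2) = (\<Sum>i<N. lc (of_int (a i)) (of_int (b i)) (of_int (c i)) (of_int (w i)) / 16)"
    by (rule sum.cong) (simp_all add: sq)
  also have "\<dots> = (\<Sum>i<N. lc (of_int (a i)) (of_int (b i)) (of_int (c i)) (of_int (w i))) / 16"
    by (simp add: sum_divide_distrib)
  finally have "lc (of_int (4 * A)) (of_int (4 * B)) (of_int (4 * C)) (of_int (4 * W))
      = lc (\<Sum>i<N. of_int (a i)) (\<Sum>i<N. of_int (b i)) (\<Sum>i<N. of_int (c i)) (\<Sum>i<N. of_int (w i))"
  proof -
    assume "(\<Sum>i<N. (f i)\<^sup>2)
      = (\<Sum>i<N. lc (of_int (a i)) (of_int (b i)) (of_int (c i)) (of_int (w i))) / 16"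
    moreover have "lc (of_int (4 * A)) (of_int (4 * B)) (of_int (4 * C)) (of_int (4 * W))
      = 4 * lc (of_int A) (of_int B) (of_int C) (of_int W)"
      by (simp add: lc_def)
    ultimately show ?thesis using sum unfolding lc_sum by linarith
  qed
  then have "lc (of_int (4 * A)) (of_int (4 * B)) (of_int (4 * C)) (of_int (4 * W))
      = lc (of_int (\<Sum>i<N. a i)) (of_int (\<Sum>i<N. b i)) (of_int (\<Sum>i<N. c i)) (of_int (\<Sum>i<N. w i))"
    unfolding of_int_sum .
  then have "real_of_int (4 * A) = of_int (\<Sum>i<N. a i) \<and> real_of_int (4 * B) = of_int (\<Sum>i<N. b i)
      \<and> real_of_int (4 * C) = of_int (\<Sum>i<N. c i) \<and> real_of_int (4 * W) = of_int (\<Sum>i<N. w i)"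
    by (rule lc_eq_iff[OF Rats_of_int Rats_of_int Rats_of_int Rats_of_int
        Rats_of_int Rats_of_int Rats_of_int Rats_of_int, THEN iffD1])
  then have eq: "(\<Sum>i<N. a i) = 4 * A" "(\<Sum>i<N. b i) = 4 * B"
    unfolding of_int_eq_iff by simp_all
  show ?thesis
    by (rule that[OF xyzt(1) eq(1)[unfolded a_def] eq(2)[unfolded b_def]])
qed

section \<open>A lower bound for the trace of a sum of squares\<close>

text \<open>A is the trace. Its smallness kills all t, so every y is even, and B \<noteq> 0 makes V
  = \<Sum>y^2 at least 4. By Cauchy-Schwarz, 4A is at least g d V + 4B^2/V, which for V \<ge> 4 is
  smallest at V = 4, because B^2 \<le> 4 g d.\<close>

lemma trace_lower_bound:
  assumes "lc (of_int A) (of_int B) (of_int C) (of_int W) / 4 \<in> sums_of_squares (ring_of_integers K)"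
    and small: "4 * A < d * e" and "B \<noteq> 0" and B: "B\<^sup>2 \<le> 4 * (g * d)"
  shows "4 * (g * d) + B\<^sup>2 \<le> 4 * A"
proof -
  from assms(1) obtain N :: nat and x y z t where quad: "\<And>i. i < N \<Longrightarrow> integral_quad (x i) (y i) (z i) (t i)"
    and A: "(\<Sum>i<N. (x i)\<^sup>2 + g * d * (y i)\<^sup>2 + g * e * (z i)\<^sup>2 + d * e * (t i)\<^sup>2) = 4 * A"
    and Beq: "(\<Sum>i<N. 2 * (x i * y i) + 2 * e * (z i * t i)) = 4 * B"
    by (rule sums_of_squares_coords) (rule that)
  have t: "t i = 0" if "i < N" for i
  proof (rule ccontr)
    assume "t i \<noteq> 0"
    then have "(t i)\<^sup>2 \<ge> 1" using zero_less_power2[of "t i"] by linarith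
    then have "d * e * 1 \<le> d * e * (t i)\<^sup>2" using pos by (intro mult_left_mono) simp_all
    also have "\<dots> \<le> (x i)\<^sup>2 + g * d * (y i)\<^sup>2 + g * e * (z i)\<^sup>2 + d * e * (t i)\<^sup>2"
      using pos by simp
    also have "\<dots> \<le> (\<Sum>i<N. (x i)\<^sup>2 + g * d * (y i)\<^sup>2 + g * e * (z i)\<^sup>2 + d * e * (t i)\<^sup>2)"
      using pos that by (intro member_le_sum) simp_all
    finally show False using small unfolding A by simp
  qed
  have even: "even (y i)" if "i < N" for i
    using quad[OF that] t[OF that] unfolding integral_quad_def by presburger
  define U V where "U = (\<Sum>i<N. (x i)\<^sup>2)" and "V = (\<Sum>i<N. (y i)\<^sup>2)"
  have "U + g * d * V = (\<Sum>i<N. (x i)\<^sup>2 + g * d * (y i)\<^sup>2)"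
    by (simp add: U_def V_def sum.distrib sum_distrib_left)
  also have "\<dots> \<le> 4 * A" unfolding A[symmetric] using pos by (intro sum_mono) simp
  finally have UV: "U + g * d * V \<le> 4 * A" .
  have "(\<Sum>i<N. 2 * (x i * y i) + 2 * e * (z i * t i)) = (\<Sum>i<N. 2 * (x i * y i))"
    by (rule sum.cong) (simp_all add: t)
  with Beq have xy: "(\<Sum>i<N. x i * y i) = 2 * B" by (simp flip: sum_distrib_left)
  have CS: "(2 * B)\<^sup>2 \<le> U * V"
  proof -
    have "(\<Sum>i<N. of_int (x i) * of_int (y i) :: real)\<^sup>2
        \<le> (\<Sum>i<N. (of_int (x i))\<^sup>2) * (\<Sum>i<N. (of_int (y i))\<^sup>2)"
      by (rule Cauchy_Schwarz_ineq_sum)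
    then have "real_of_int ((\<Sum>i<N. x i * y i)\<^sup>2) \<le> of_int (U * V)"
      by (simp add: U_def V_def)
    then show ?thesis by (simp only: of_int_le_iff xy)
  qed
  have "\<exists>i<N. y i \<noteq> 0"
  proof (rule ccontr)
    assume "\<not> (\<exists>i<N. y i \<noteq> 0)"
    then have "(\<Sum>i<N. x i * y i) = 0" by (intro sum.neutral) simp
    with xy \<open>B \<noteq> 0\<close> show False by simp
  qed
  then obtain i where i: "i < N" "y i \<noteq> 0" by blast
  with even[of i] obtain k where k: "y i = 2 * k" "k \<noteq> 0" by (auto elim: evenE)
  have "k\<^sup>2 \<ge> 1" using k(2) zero_less_power2[of k] by linarith
  then have "4 \<le> (y i)\<^sup>2" unfolding k(1) power_mult_distrib by simp
  also have "\<dots> \<le> V" unfolding V_def using i(1) by (intro member_le_sum) simp_all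
  finally have V: "V \<ge> 4" .
  have "g * d * 4 \<le> g * d * V" using V pos by (intro mult_left_mono) simp_all
  \<comment> \<open>Expanded, this product is the comparison of g d V + 4B^2/V with its value at V =
    4, multiplied by V.\<close>
  with B have "0 \<le> (V - 4) * (g * d * V - B\<^sup>2)" using V by (intro mult_nonneg_nonneg) simp_all
  with CS have "(4 * (g * d) + B\<^sup>2) * V \<le> (U + g * d * V) * V"
    by (simp add: algebra_simps power2_eq_square)
  then have "4 * (g * d) + B\<^sup>2 \<le> U + g * d * V" using V by (subst (asm) mult_le_cancel_right_pos) simp_all
  with UV show ?thesis by linarith
qed

section \<open>Descent to the quadratic subfield\<close>

lemma half_tot_pos:
  assumes "even (a - b)" "of_int a > \<bar>of_int b\<bar> * sP"
  shows "(of_int a + of_int b * sP) / 2 \<in> tot_pos_integers (rat_adjoin {sP})"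
proof -
  have sP: "sP \<in> rat_adjoin {sP}" "sP\<^sup>2 \<in> \<rat>"
    by (simp_all add: rat_adjoin_base power2_eq_square s_mult)
  have "of_int a / 2 + of_int b / 2 * sP + 0 * sP + 0 * sP \<in> tot_pos_integers (rat_adjoin {sP})"
  proof (rule tot_pos_integersI[OF _ _ _ _ sP sP sP])
    have "algebraic_int ((of_int a + of_int b * sqrt (of_int (g * d))) / 2 :: real)"
      using gt mod4 assms(1) by (intro algebraic_int_half_integers) simp_all
    then show "algebraic_int (of_int a / 2 + of_int b / 2 * sP + 0 * sP + 0 * sP)"
      by (simp add: sP_def add_divide_distrib)
  qed (use assms(2) s_pos in \<open>simp_all add: abs_mult\<close>)
  then show ?thesis by (simp add: add_divide_distrib)
qed

text \<open>The form arises from (z\<surd>q + t\<surd>r)^2 = e(g z^2 + d t^2 + 2 z t \<surd>p), the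
  square of the part outside \<rat>(\<surd>p); \<sigma> = -1 gives its conjugate. Multiplied by g it
  becomes a square in that field, which settles its sign.\<close>

lemma square_form_identity:
  fixes z t \<sigma> :: real
  assumes "\<sigma> * \<sigma> = 1"
  shows "of_int g * (of_int g * z\<^sup>2 + of_int d * t\<^sup>2 + 2 * \<sigma> * z * t * sP) = (of_int g * z + \<sigma> * t * sP)\<^sup>2"
proof -
  have "(of_int g * z + \<sigma> * t * sP)\<^sup>2
      = (of_int g * z)\<^sup>2 + 2 * (of_int g * z) * (\<sigma> * t * sP) + (\<sigma> * \<sigma>) * t\<^sup>2 * (sP * sP)"
    by (simp add: power2_eq_square algebra_simps)
  also have "\<dots> = of_int g * (of_int g * z\<^sup>2 + of_int d * t\<^sup>2 + 2 * \<sigma> * z * t * sP)"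
    unfolding assms s_mult by (simp add: power2_eq_square algebra_simps)
  finally show ?thesis by (rule sym)
qed

lemma square_form_pos:
  fixes z t :: int
  assumes \<sigma>: "\<sigma> * \<sigma> = 1" "\<sigma> \<in> \<rat>"
  shows "of_int g * (of_int z)\<^sup>2 + of_int d * (of_int t)\<^sup>2 + 2 * \<sigma> * of_int z * of_int t * sP \<ge> 0"
    and "z \<noteq> 0 \<or> t \<noteq> 0 \<Longrightarrow>
      of_int g * (of_int z)\<^sup>2 + of_int d * (of_int t)\<^sup>2 + 2 * \<sigma> * of_int z * of_int t * sP > 0"
proof -
  define q where "q = of_int g * (of_int z)\<^sup>2 + of_int d * (of_int t)\<^sup>2 + 2 * \<sigma> * of_int z * of_int t * sP"
  have eq: "of_int g * q = (of_int g * of_int z + \<sigma> * of_int t * sP)\<^sup>2"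
    unfolding q_def by (rule square_form_identity[OF \<sigma>(1)])
  have "0 \<le> of_int g * q" unfolding eq by simp
  then have q: "q \<ge> 0" using pos by (simp add: zero_le_mult_iff)
  then show "of_int g * (of_int z)\<^sup>2 + of_int d * (of_int t)\<^sup>2 + 2 * \<sigma> * of_int z * of_int t * sP \<ge> 0"
    by (simp only: q_def)
  assume nz: "z \<noteq> 0 \<or> t \<noteq> 0"
  have "q \<noteq> 0"
  proof
    assume "q = 0"
    with eq have "of_int g * of_int z + \<sigma> * of_int t * sP = 0" by simp
    note indep = irrational_lin_indep[OF s_irrational(1) _ _ this]
    have "of_int g * of_int z = (0::real)" "\<sigma> * of_int t = 0"
      by (rule indep; use \<sigma>(2) in simp)+
    with \<sigma>(1) pos nz show False by auto
  qed
  with q show "of_int g * (of_int z)\<^sup>2 + of_int d * (of_int t)\<^sup>2 + 2 * \<sigma> * of_int z * of_int t * sP > 0"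
    unfolding q_def by simp
qed


text \<open>Since g d \<equiv> 1 (mod 4), both factors are odd and congruent modulo 4. The
  conclusion makes a quarter of the form above equal to (c + z t \<surd>p)/2 with c \<equiv> z t
  (mod 2), an algebraic integer.\<close>

lemma g_d_parity:
  fixes z t :: int
  assumes "even (z - t)"
  obtains c where "g * z\<^sup>2 + d * t\<^sup>2 = 2 * c" "even (c - z * t)"
proof -
  have "g * d mod 4 = 1" by (rule mod4(1))
  then have gd: "(g mod 4) * (d mod 4) mod 4 = 1" by (simp add: mod_mult_eq)
  have "g mod 4 \<in> {0, 1, 2, 3}" "d mod 4 \<in> {0, 1, 2, 3}" by auto
  with gd have "g mod 4 = 1 \<and> d mod 4 = 1 \<or> g mod 4 = 3 \<and> d mod 4 = 3" by auto
  then have "4 dvd g - d" "odd g" by presburger+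
  then obtain k where k: "g = d + 4 * k" by (metis add.commute diff_add_cancel dvd_def)
  obtain j where j: "z = t + 2 * j" using assms by (metis add.commute diff_add_cancel evenE)
  obtain h where h: "d = 2 * h + 1" using \<open>odd g\<close> k by (metis even_add even_mult_iff even_numeral oddE)
  show ?thesis
  proof (rule that)
    show "g * z\<^sup>2 + d * t\<^sup>2 = 2 * (d * (t\<^sup>2 + 2 * j * t + 2 * j\<^sup>2) + 2 * k * z\<^sup>2)"
      unfolding k j by (simp add: power2_eq_square algebra_simps)
    have "d * (t\<^sup>2 + 2 * j * t + 2 * j\<^sup>2) + 2 * k * z\<^sup>2 - z * t
        = 2 * (h * t\<^sup>2 + d * j * t + d * j\<^sup>2 + k * z\<^sup>2 - j * t)"
      unfolding j h by (simp add: power2_eq_square algebra_simps)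
    then show "even (d * (t\<^sup>2 + 2 * j * t + 2 * j\<^sup>2) + 2 * k * z\<^sup>2 - z * t)" by (rule dvdI)
  qed
qed

text \<open>The left side is the \<rat>(\<surd>p)-part of the square of x + y\<surd>p + z\<surd>q +
  t\<surd>r, or its conjugate for \<sigma> = -1. It splits into the squares of the components inside
  and outside that field.\<close>

lemma square_split:
  fixes x y z t \<sigma> :: real
  assumes "\<sigma> * \<sigma> = 1"
  shows "x\<^sup>2 + of_int g * of_int d * y\<^sup>2 + of_int g * of_int e * z\<^sup>2 + of_int d * of_int e * t\<^sup>2
      + \<sigma> * sP * (2 * (x * y) + 2 * of_int e * (z * t))
    = (x + \<sigma> * y * sP)\<^sup>2 + of_int e * (of_int g * z\<^sup>2 + of_int d * t\<^sup>2 + 2 * \<sigma> * z * t * sP)"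
proof -
  have "(x + \<sigma> * y * sP)\<^sup>2 = x\<^sup>2 + 2 * x * (\<sigma> * y * sP) + (\<sigma> * \<sigma>) * y\<^sup>2 * (sP * sP)"
    by (simp add: power2_eq_square algebra_simps)
  then have sq: "(x + \<sigma> * y * sP)\<^sup>2 = x\<^sup>2 + 2 * x * (\<sigma> * y * sP) + y\<^sup>2 * (of_int g * of_int d)"
    unfolding assms s_mult of_int_mult by (simp only: mult_1_left)
  have "x\<^sup>2 + G * D * y\<^sup>2 + G * E * z\<^sup>2 + D * E * t\<^sup>2 + \<sigma> * s * (2 * (x * y) + 2 * E * (z * t))
      = (x\<^sup>2 + 2 * x * (\<sigma> * y * s) + y\<^sup>2 * (G * D)) + E * (G * z\<^sup>2 + D * t\<^sup>2 + 2 * \<sigma> * z * t * s)"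
    for G D E s :: real
    by (simp add: algebra_simps)
  then show ?thesis unfolding sq .
qed

lemma multiple_half_eq_lc:
  "of_int m * ((of_int a + of_int b * sP) / 2)
    = lc (of_int (2 * m * a)) (of_int (2 * m * b)) (of_int 0) (of_int 0) / 4"
proof -
  have "u * ((v + w * s) / 2) = (2 * u * v + 2 * u * w * s + 0 * s' + 0 * s'') / 4"
    for u v w s s' s'' :: real by (simp add: distrib_left)
  then show ?thesis unfolding lc_def of_int_mult of_int_numeral of_int_0 .
qed

text \<open>Descent on the trace. In a representation over \<open>K\<close>, a summand that is not in
  \<open>\<rat>(\<surd>(g d))\<close> contributes \<open>(e/4) \<theta>\<close> with \<open>\<theta>\<close> a totally positive integer of that field; as
  \<open>e > 4 m\<close>, the difference \<open>\<alpha> - \<theta>\<close> is still totally positive, and both \<open>\<theta>\<close> and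
  \<open>\<alpha> - \<theta>\<close> have smaller trace.\<close>

lemma descent:
  fixes m a b :: int
  assumes m: "m > 0" "e > 4 * m"
    and all: "\<And>\<alpha>. \<alpha> \<in> tot_pos_integers (rat_adjoin {sP}) \<Longrightarrow>
      of_int m * \<alpha> \<in> sums_of_squares (ring_of_integers K)"
    and "even (a - b)" "of_int a > \<bar>of_int b\<bar> * sP"
  shows "quad_sum_of_squares (g * d) (2 * m * a) (m * b)"
  using assms(4,5)
proof (induction "nat a" arbitrary: a b rule: less_induct)
  case (less a b)
  have "lc (of_int (2 * m * a)) (of_int (2 * m * b)) (of_int 0) (of_int 0) / 4
      \<in> sums_of_squares (ring_of_integers K)"
    unfolding multiple_half_eq_lc[symmetric] by (rule all[OF half_tot_pos[OF less.prems]])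
  then obtain N :: nat and x y z t where quad: "\<And>i. i < N \<Longrightarrow> integral_quad (x i) (y i) (z i) (t i)"
    and A: "(\<Sum>i<N. (x i)\<^sup>2 + g * d * (y i)\<^sup>2 + g * e * (z i)\<^sup>2 + d * e * (t i)\<^sup>2) = 4 * (2 * m * a)"
    and B: "(\<Sum>i<N. 2 * (x i * y i) + 2 * e * (z i * t i)) = 4 * (2 * m * b)"
    by (rule sums_of_squares_coords) (rule that)
  show ?case
  proof (cases "\<forall>i<N. z i = 0 \<and> t i = 0")
    case True
    \<comment> \<open>All summands already lie in \<rat>(\<surd>p). Halving passes from denominator
      4 to 2, and 4 dividing x - y becomes the required parity.\<close>
    define x' y' where "x' i = x i div 2" and "y' i = y i div 2" for i
    have xy: "x i = 2 * x' i" "y i = 2 * y' i" "even (x' i - y' i)" if "i < N" for i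
    proof -
      have "even (x i)" "even (y i)" "4 dvd x i - y i"
        using quad[OF that] True[rule_format, OF that] unfolding integral_quad_def by auto
      then show "x i = 2 * x' i" "y i = 2 * y' i" "even (x' i - y' i)"
        unfolding x'_def y'_def by presburger+
    qed
    have "(\<Sum>i<N. (x i)\<^sup>2 + g * d * (y i)\<^sup>2 + g * e * (z i)\<^sup>2 + d * e * (t i)\<^sup>2)
        = 4 * (\<Sum>i<N. (x' i)\<^sup>2 + g * d * (y' i)\<^sup>2)"
      unfolding sum_distrib_left by (rule sum.cong) (simp_all add: True xy power_mult_distrib algebra_simps)
    then have A': "(\<Sum>i<N. (x' i)\<^sup>2 + g * d * (y' i)\<^sup>2) = 2 * m * a"
      using A by linarith
    have "(\<Sum>i<N. 2 * (x i * y i) + 2 * e * (z i * t i)) = 8 * (\<Sum>i<N. x' i * y' i)"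
      unfolding sum_distrib_left by (rule sum.cong) (simp_all add: True xy)
    then have B': "(\<Sum>i<N. x' i * y' i) = m * b"
      using B by linarith
    have "(\<forall>i<N. even (x' i - y' i)) \<and> (\<Sum>i<N. (x' i)\<^sup>2 + g * d * (y' i)\<^sup>2) = 2 * m * a \<and>
        (\<Sum>i<N. x' i * y' i) = m * b"
      using A' B' xy(3) by simp
    then show ?thesis unfolding quad_sum_of_squares_def by (intro exI)
  next
    case False
    then obtain j where j: "j < N" "z j \<noteq> 0 \<or> t j \<noteq> 0" by auto
    have "even (z j - t j)" using quad[OF j(1)] unfolding integral_quad_def by presburger
    then obtain c where c: "g * (z j)\<^sup>2 + d * (t j)\<^sup>2 = 2 * c" "even (c - z j * t j)"
      by (rule g_d_parity) (rule that)
    define h where "h = z j * t j"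
    define form where "form \<sigma> i = of_int g * (of_int (z i))\<^sup>2 + of_int d * (of_int (t i))\<^sup>2
      + 2 * \<sigma> * of_int (z i) * of_int (t i) * sP" for \<sigma> i
    have "real_of_int (g * (z j)\<^sup>2 + d * (t j)\<^sup>2) = of_int (2 * c)" by (simp only: c(1))
    then have "of_int g * (of_int (z j))\<^sup>2 + of_int d * (of_int (t j))\<^sup>2 = 2 * real_of_int c" by simp
    then have form_j: "form \<sigma> j = 2 * (of_int c + \<sigma> * (of_int h * sP))" for \<sigma>
      unfolding form_def h_def of_int_mult by (simp only: distrib_left mult.assoc)
    \<comment> \<open>The summand \<open>j\<close> yields \<theta> = (c + h\<surd>p)/2. The two
      values of \<sigma> are the two embeddings of \<rat>(\<surd>p), so these inequalities say that
      \<theta> and \<alpha> - \<theta> are totally positive.\<close>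
    have pos_signs: "of_int c + \<sigma> * (of_int h * sP) > 0"
      "of_int (a - c) + \<sigma> * (of_int (b - h) * sP) > 0" if \<sigma>: "\<sigma> = 1 \<or> \<sigma> = - 1" for \<sigma>
    proof -
      have \<sigma>': "\<sigma> * \<sigma> = 1" "\<sigma> \<in> \<rat>" using \<sigma> by auto
      have form_nonneg: "form \<sigma> i \<ge> 0" for i unfolding form_def by (rule square_form_pos(1)[OF \<sigma>'])
      have "form \<sigma> j > 0" unfolding form_def by (rule square_form_pos(2)[OF \<sigma>' j(2)])
      then show ch: "of_int c + \<sigma> * (of_int h * sP) > 0" unfolding form_j by simp
      have term_eq: "of_int ((x i)\<^sup>2 + g * d * (y i)\<^sup>2 + g * e * (z i)\<^sup>2 + d * e * (t i)\<^sup>2)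
          + \<sigma> * sP * of_int (2 * (x i * y i) + 2 * e * (z i * t i))
        = (of_int (x i) + \<sigma> * of_int (y i) * sP)\<^sup>2 + of_int e * form \<sigma> i" for i
        unfolding form_def of_int_add of_int_mult of_int_power of_int_numeral
        by (rule square_split[OF \<sigma>'(1)])
      have "of_int (4 * (2 * m * a)) + \<sigma> * sP * of_int (4 * (2 * m * b))
        = (\<Sum>i<N. of_int ((x i)\<^sup>2 + g * d * (y i)\<^sup>2 + g * e * (z i)\<^sup>2 + d * e * (t i)\<^sup>2)
          + \<sigma> * sP * of_int (2 * (x i * y i) + 2 * e * (z i * t i)))"
      proof -
        have "of_int (\<Sum>i<N. u i) + k * of_int (\<Sum>i<N. v i) = (\<Sum>i<N. of_int (u i) + k * of_int (v i))"
          for u v :: "nat \<Rightarrow> int" and k :: real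
          by (simp add: sum.distrib sum_distrib_left)
        then show ?thesis unfolding A[symmetric] B[symmetric] .
      qed
      also have "\<dots> = (\<Sum>i<N. (of_int (x i) + \<sigma> * of_int (y i) * sP)\<^sup>2 + of_int e * form \<sigma> i)"
        unfolding term_eq ..
      also have "\<dots> \<ge> (of_int (x j) + \<sigma> * of_int (y j) * sP)\<^sup>2 + of_int e * form \<sigma> j"
        using j(1) form_nonneg pos by (intro member_le_sum) simp_all
      finally have "of_int (4 * (2 * m * a)) + \<sigma> * sP * of_int (4 * (2 * m * b))
          \<ge> (of_int (x j) + \<sigma> * of_int (y j) * sP)\<^sup>2 + of_int e * form \<sigma> j" .
      then have "of_int e * form \<sigma> j \<le> of_int (4 * (2 * m * a)) + \<sigma> * sP * of_int (4 * (2 * m * b))"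
        using zero_le_power2[of "of_int (x j) + \<sigma> * of_int (y j) * sP"] by linarith
      also have "\<dots> = 8 * of_int m * (of_int a + \<sigma> * (of_int b * sP))"
      proof -
        have "4 * (2 * u * v) + \<sigma> * s * (4 * (2 * u * w)) = 8 * u * (v + \<sigma> * (w * s))" for u v w s :: real
          by (simp add: algebra_simps)
        then show ?thesis unfolding of_int_mult of_int_numeral .
      qed
      finally have le: "of_int e * form \<sigma> j \<le> 8 * of_int m * (of_int a + \<sigma> * (of_int b * sP))" .
      \<comment> \<open>Dropping all squares but one bounds e times the form by 8m times the
        conjugate of a + b\<surd>p; replacing e by the smaller 4m makes the comparison
        strict.\<close>
      have "of_int (4 * m) * form \<sigma> j < of_int e * form \<sigma> j"
        using m(2) \<open>form \<sigma> j > 0\<close> by (intro mult_strict_right_mono) (simp_all only: of_int_less_iff)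
      moreover have "of_int (4 * m) * form \<sigma> j = 8 * of_int m * (of_int c + \<sigma> * (of_int h * sP))"
        unfolding form_j of_int_mult of_int_numeral by simp
      ultimately have "8 * of_int m * (of_int c + \<sigma> * (of_int h * sP)) < of_int e * form \<sigma> j"
        by (simp only:)
      with le have "8 * of_int m * (of_int c + \<sigma> * (of_int h * sP))
          < 8 * of_int m * (of_int a + \<sigma> * (of_int b * sP))" by linarith
      then have "of_int c + \<sigma> * (of_int h * sP) < of_int a + \<sigma> * (of_int b * sP)"
        using m(1) by (subst (asm) mult_less_cancel_left_pos) simp_all
      then show "of_int (a - c) + \<sigma> * (of_int (b - h) * sP) > 0"
        unfolding of_int_diff left_diff_distrib right_diff_distrib by linarith
    qed
    have abs_bound: "of_int u > \<bar>of_int v\<bar> * sP"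
      if "of_int u + 1 * (of_int v * sP) > 0" "of_int u + (- 1) * (of_int v * sP) > 0" for u v :: int
    proof -
      have "\<bar>of_int v\<bar> * sP = \<bar>of_int v * sP\<bar>" using s_pos(1) by (simp add: abs_mult)
      with that show ?thesis by linarith
    qed
    have ch: "of_int c > \<bar>of_int h\<bar> * sP"
      by (rule abs_bound) (rule pos_signs; simp)+
    have ac: "of_int (a - c) > \<bar>of_int (b - h)\<bar> * sP"
      by (rule abs_bound) (rule pos_signs; simp)+
    have "0 \<le> \<bar>of_int h\<bar> * sP" "0 \<le> \<bar>of_int (b - h)\<bar> * sP" using s_pos(1) by simp_all
    with ch ac have "real_of_int 0 < of_int c" "real_of_int 0 < of_int (a - c)" by simp_all
    \<comment> \<open>Both c and a - c are positive, so both are smaller than a and the induction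
      hypothesis applies to \<theta> and \<alpha> - \<theta>.\<close>
    then have pos': "c > 0" "a - c > 0" by (simp_all only: of_int_less_iff)
    have "quad_sum_of_squares (g * d) (2 * m * c) (m * h)"
      using pos' c(2) ch by (intro less.hyps) (simp_all add: h_def)
    moreover have "quad_sum_of_squares (g * d) (2 * m * (a - c)) (m * (b - h))"
    proof (rule less.hyps)
      show "nat (a - c) < nat a" using pos' by simp
      show "even (a - c - (b - h))" using less.prems(1) c(2) unfolding h_def by presburger
    qed (rule ac)
    ultimately have "quad_sum_of_squares (g * d) (2 * m * c + 2 * m * (a - c)) (m * h + m * (b - h))"
      by (rule quad_sum_of_squares_add)
    then show ?thesis by (simp add: algebra_simps)
  qed
qed

lemma not_all_multiples_sums_of_squares:
  fixes m :: int
  assumes "m > 0" "e > 4 * m" "g * d \<ge> (m + 8)\<^sup>2"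
  shows "\<not> (\<lambda>\<alpha>. of_int m * \<alpha>) ` tot_pos_integers (rat_adjoin {sP}) \<subseteq> sums_of_squares (ring_of_integers K)"
proof
  assume sub: "(\<lambda>\<alpha>. of_int m * \<alpha>) ` tot_pos_integers (rat_adjoin {sP}) \<subseteq> sums_of_squares (ring_of_integers K)"
  show False
  proof (rule not_sum_of_squares_quadratic[OF assms(1,3)])
    fix a b :: int
    assume ab: "even (a - b)" "of_int a > \<bar>of_int b\<bar> * sqrt (of_int (g * d))"
      and no: "\<nexists>(N::nat) x y. (\<forall>i<N. even (x i - y i)) \<and>
        (\<Sum>i<N. (x i)\<^sup>2 + g * d * (y i)\<^sup>2) = 2 * m * a \<and> (\<Sum>i<N. x i * y i) = m * b"
    have "quad_sum_of_squares (g * d) (2 * m * a) (m * b)"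
      by (rule descent[OF assms(1,2)]) (use sub ab in \<open>auto simp: sP_def\<close>)
    with no show False unfolding quad_sum_of_squares_def by blast
  qed
qed

end

section \<open>Elements of almost minimal trace\<close>

lemma int_above_one_mod_4:
  obtains a :: int where "a mod 4 = 1" "t < of_int a" "of_int a \<le> t + (4 :: real)"
proof -
  define k where "k = \<lfloor>(t - 1) / 4\<rfloor> + 1"
  have "(t - 1) / 4 < of_int k" "of_int k \<le> (t - 1) / 4 + 1" unfolding k_def by linarith+
  then have "t < 4 * of_int k + 1" "4 * of_int k + 1 \<le> t + 4" by (simp_all add: field_simps)
  then have "t < of_int (4 * k + 1)" "of_int (4 * k + 1) \<le> t + 4" by simp_all
  moreover have "(4 * k + 1) mod 4 = 1" by presburger
  ultimately show ?thesis by (intro that)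
qed

context biquad
begin

text \<open>For \<alpha> = (a + \<surd>p)/2 with a \<le> \<surd>p + 2, the trace of m\<alpha> from K
  is 2ma. The lower bound becomes p + m^2 \<le> 2ma \<le> 2m(\<surd>p + 2), that is (\<surd>p - m)^2
  \<le> 4m.\<close>

lemma not_all_multiples_by_trace:
  fixes m :: int
  assumes m: "m > 0" "m\<^sup>2 \<le> g * d" and small: "8 * of_int m * (sP + 2) < of_int (d * e)"
    and large: "(sP - of_int m)\<^sup>2 > 4 * of_int m"
  shows "\<not> (\<lambda>\<alpha>. of_int m * \<alpha>) ` tot_pos_integers (rat_adjoin {sP}) \<subseteq> sums_of_squares (ring_of_integers K)"
proof
  assume sub: "(\<lambda>\<alpha>. of_int m * \<alpha>) ` tot_pos_integers (rat_adjoin {sP}) \<subseteq> sums_of_squares (ring_of_integers K)"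
  obtain a where a: "even (a - 1)" "sP < of_int a" "of_int a \<le> sP + 2"
    using int_above_with_parity[of 1 sP] by blast
  have "(of_int a + of_int 1 * sP) / 2 \<in> tot_pos_integers (rat_adjoin {sP})"
    by (rule half_tot_pos[OF a(1)]) (use a(2) in simp)
  with sub have "of_int m * ((of_int a + of_int 1 * sP) / 2) \<in> sums_of_squares (ring_of_integers K)"
    by blast
  then have mem: "lc (of_int (2 * m * a)) (of_int (2 * m * 1)) (of_int 0) (of_int 0) / 4
      \<in> sums_of_squares (ring_of_integers K)"
    unfolding multiple_half_eq_lc .
  have ma: "of_int m * of_int a \<le> of_int m * (sP + 2)"
    using a(3) m(1) by (intro mult_left_mono) simp_all
  have "of_int (4 * (2 * m * a)) = 8 * (of_int m * real_of_int a)" by simp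
  with ma small have "real_of_int (4 * (2 * m * a)) < of_int (d * e)" by linarith
  then have "4 * (2 * m * a) < d * e" by (simp only: of_int_less_iff)
  moreover have "(2 * m * 1)\<^sup>2 \<le> 4 * (g * d)" using m(2) by (simp add: power_mult_distrib)
  ultimately have "4 * (g * d) + (2 * m * 1)\<^sup>2 \<le> 4 * (2 * m * a)"
    using m(1) by (intro trace_lower_bound[OF mem]) simp_all
  then have "g * d + m\<^sup>2 \<le> 2 * (m * a)" by (simp add: power_mult_distrib)
  then have "real_of_int (g * d + m\<^sup>2) \<le> of_int (2 * (m * a))" by (simp only: of_int_le_iff)
  then have "real_of_int (g * d) + (of_int m)\<^sup>2 \<le> 2 * (of_int m * of_int a)" by simp
  with ma have "sP * sP + (of_int m)\<^sup>2 \<le> 2 * (of_int m * (sP + 2))" unfolding s_mult by linarith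
  moreover have "(sP - of_int m)\<^sup>2 = sP * sP + (of_int m)\<^sup>2 - 2 * (of_int m * sP)"
    by (simp add: power2_eq_square algebra_simps)
  ultimately show False using large by (simp add: distrib_left)
qed

text \<open>The product of (1 + \<epsilon>\<surd>p)/2 and (1 + \<surd>q)/2 is (1 +
  \<epsilon>\<surd>p + \<surd>q + \<epsilon>g\<surd>r)/4. As a \<equiv> \<epsilon>g \<equiv> 1 (mod
  4), it differs from the given element by integer multiples of 1 and \<surd>r.\<close>

lemma algebraic_int_quarter:
  fixes a \<epsilon> :: int
  assumes a: "a mod 4 = 1" and \<epsilon>: "\<epsilon> = 1 \<or> \<epsilon> = - 1" "4 dvd 1 - \<epsilon> * g"
  shows "algebraic_int (lc (of_int a) (of_int \<epsilon>) 1 1 / 4)"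
proof -
  have of_int: "algebraic_int (of_int i :: real)" for i
    by (rule int_imp_algebraic_int) simp
  obtain k where k: "a = 1 + 4 * k" using a by (metis add.commute mult_div_mod_eq)
  obtain j where j: "1 - \<epsilon> * g = 4 * j" using \<epsilon>(2) by (elim dvdE)
  have "algebraic_int ((of_int 1 + of_int \<epsilon> * sqrt (of_int (g * d))) / 2 :: real)"
    using gt mod4 \<epsilon>(1) by (intro algebraic_int_half_integers) auto
  moreover have "algebraic_int ((of_int 1 + of_int 1 * sqrt (of_int (g * e))) / 2 :: real)"
    using gt mod4 by (intro algebraic_int_half_integers) simp_all
  ultimately have "algebraic_int ((of_int 1 + of_int \<epsilon> * sP) / 2 * ((of_int 1 + of_int 1 * sQ) / 2))"
    unfolding sP_def sQ_def by (rule algebraic_int_add_mult)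
  moreover have "algebraic_int sR"
    unfolding sR_def by (intro algebraic_int_sqrt int_imp_algebraic_int Ints_of_int)
  ultimately have int: "algebraic_int (of_int k + of_int j * sR
      + (of_int 1 + of_int \<epsilon> * sP) / 2 * ((of_int 1 + of_int 1 * sQ) / 2))"
    by (rule algebraic_int_add_mult(1)[OF algebraic_int_add_mult(1)[OF of_int algebraic_int_add_mult(2)[OF of_int]], rotated])
  have gR: "sP * sQ = of_int g * sR" by (rule s_mult)
  have "real_of_int (1 - \<epsilon> * g) = of_int (4 * j)" by (simp only: j)
  then have "4 * real_of_int j = 1 - of_int \<epsilon> * of_int g" by simp
  then have "4 * real_of_int j * sR = (1 - of_int \<epsilon> * of_int g) * sR" by simp
  then have j': "4 * (of_int j * sR) = sR - of_int \<epsilon> * (of_int g * sR)"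
    by (simp only: left_diff_distrib mult_1_left mult.assoc)
  have "(1 + u * sP) / 2 * ((1 + 1 * sQ) / 2) = (1 + u * sP + sQ + u * (sP * sQ)) / 4" for u
    by (simp add: algebra_simps)
  then have prod: "(of_int 1 + of_int \<epsilon> * sP) / 2 * ((of_int 1 + of_int 1 * sQ) / 2)
      = (1 + of_int \<epsilon> * sP + sQ + of_int \<epsilon> * (of_int g * sR)) / 4"
    unfolding gR of_int_1 .
  have "of_int k + of_int j * sR + (of_int 1 + of_int \<epsilon> * sP) / 2 * ((of_int 1 + of_int 1 * sQ) / 2)
      = lc (of_int a) (of_int \<epsilon>) 1 1 / 4"
  proof -
    have "t + u + (1 + v + w + x) / 4 = (1 + 4 * t + v + 1 * w + 1 * s) / 4" if "4 * u = s - x"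
      for t u v w x s :: real
    proof -
      have "u = (s - x) / 4" using that by simp
      then show ?thesis by (simp add: field_simps)
    qed
    from this[OF j'] show ?thesis
      unfolding prod unfolding lc_def k of_int_add of_int_mult of_int_numeral of_int_1 .
  qed
  with int show ?thesis by (simp only:)
qed

text \<open>With \<alpha> = (a + \<epsilon>\<surd>p + \<surd>q + \<surd>r)/4, the trace bound reads
  4p + m^2 \<le> 4ma < 4m(\<surd>p + \<surd>q + \<surd>r + 4). Completing the square in \<surd>p
  contradicts \<open>large\<close>.\<close>

lemma not_all_multiples_in_K:
  fixes m :: int
  assumes m: "m > 0" "m\<^sup>2 \<le> 4 * (g * d)"
    and small: "4 * of_int m * (sP + sQ + sR + 4) < of_int (d * e)"
    and large: "(sP - of_int m / 2)\<^sup>2 \<ge> of_int m * (sQ + sR + 4)"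
  shows "\<not> (\<lambda>\<alpha>. of_int m * \<alpha>) ` tot_pos_integers K \<subseteq> sums_of_squares (ring_of_integers K)"
proof
  assume sub: "(\<lambda>\<alpha>. of_int m * \<alpha>) ` tot_pos_integers K \<subseteq> sums_of_squares (ring_of_integers K)"
  have "odd n" if "n mod 4 = 1" for n :: int using that by presburger
  from this[OF mod4(1)] have "odd g" by simp
  \<comment> \<open>The sign with \<epsilon>g \<equiv> 1 (mod 4), as integrality of \<alpha>
    demands.\<close>
  define \<epsilon> :: int where "\<epsilon> = (if g mod 4 = 1 then 1 else - 1)"
  have \<epsilon>: "\<epsilon> = 1 \<or> \<epsilon> = - 1" "4 dvd 1 - \<epsilon> * g"
  proof -
    show "\<epsilon> = 1 \<or> \<epsilon> = - 1" by (simp add: \<epsilon>_def)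
    show "4 dvd 1 - \<epsilon> * g"
    proof (cases "g mod 4 = 1")
      case True
      then have "4 dvd 1 - g" by presburger
      with True show ?thesis by (simp add: \<epsilon>_def)
    next
      case False
      with \<open>odd g\<close> have "4 dvd 1 + g" by presburger
      with False show ?thesis by (simp add: \<epsilon>_def)
    qed
  qed
  obtain a where a: "a mod 4 = 1" "sP + sQ + sR < of_int a" "of_int a \<le> sP + sQ + sR + 4"
    using int_above_one_mod_4[of "sP + sQ + sR"] by blast
  \<comment> \<open>Linear independence makes the upper bound on a strict, which matters because
    \<open>large\<close> allows equality.\<close>
  have "of_int a \<noteq> sP + sQ + sR + 4"
  proof
    assume "of_int a = sP + sQ + sR + 4"
    then have "lc (of_int (4 - a)) 1 1 1 = 0" by (simp add: lc_def)
    then show False using lin_indep(2)[of "of_int (4 - a)" 1 1 1] by simp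
  qed
  with a(3) have a_less: "of_int a < sP + sQ + sR + 4" by simp
  have P: "sP \<in> K" "sP\<^sup>2 \<in> \<rat>" and Q: "sQ \<in> K" "sQ\<^sup>2 \<in> \<rat>"
    by (simp_all add: rat_adjoin_base power2_eq_square s_mult)
  have "sR = sP * sQ * inverse (of_int g)"
    unfolding s_mult using pos by simp
  then have R: "sR \<in> K"
    by (simp only: rat_adjoin_mult rat_adjoin_inverse rat_adjoin_of_int P Q)
  have R': "sR\<^sup>2 \<in> \<rat>" by (simp add: power2_eq_square s_mult)
  have eq: "lc (of_int a) (of_int \<epsilon>) 1 1 / 4
      = of_int a / 4 + of_int \<epsilon> / 4 * sP + 1 / 4 * sQ + 1 / 4 * sR"
    by (simp add: lc_def add_divide_distrib)
  have "lc (of_int a) (of_int \<epsilon>) 1 1 / 4 \<in> tot_pos_integers K"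
    unfolding eq
  proof (rule tot_pos_integersI[OF _ _ _ _ P Q R R'])
    show "algebraic_int (of_int a / 4 + of_int \<epsilon> / 4 * sP + 1 / 4 * sQ + 1 / 4 * sR)"
      unfolding eq[symmetric] by (rule algebraic_int_quarter[OF a(1) \<epsilon>])
    have "\<bar>real_of_int \<epsilon> / 4\<bar> = 1 / 4" using \<epsilon>(1) by auto
    then show "\<bar>real_of_int \<epsilon> / 4\<bar> * \<bar>sP\<bar> + \<bar>1 / 4\<bar> * \<bar>sQ\<bar> + \<bar>1 / 4\<bar> * \<bar>sR\<bar> < of_int a / 4"
      using a(2) s_pos by simp
  qed simp_all
  then have "of_int m * (lc (of_int a) (of_int \<epsilon>) 1 1 / 4) \<in> sums_of_squares (ring_of_integers K)"
    using sub by blast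
  moreover have "of_int m * (lc (of_int a) (of_int \<epsilon>) 1 1 / 4)
      = lc (of_int (m * a)) (of_int (m * \<epsilon>)) (of_int m) (of_int m) / 4"
  proof -
    have "u * ((v + w * sP + 1 * sQ + 1 * sR) / 4) = (u * v + u * w * sP + u * sQ + u * sR) / 4" for u v w
      by (simp add: distrib_left)
    then show ?thesis unfolding lc_def of_int_mult .
  qed
  ultimately have mem: "lc (of_int (m * a)) (of_int (m * \<epsilon>)) (of_int m) (of_int m) / 4
      \<in> sums_of_squares (ring_of_integers K)"
    by (simp only:)
  have ma: "of_int m * of_int a < of_int m * (sP + sQ + sR + 4)"
    using a_less m(1) by (intro mult_strict_left_mono) simp_all
  have "of_int (4 * (m * a)) = 4 * (of_int m * real_of_int a)" by simp
  with ma small have "real_of_int (4 * (m * a)) < of_int (d * e)" by linarith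
  then have "4 * (m * a) < d * e" by (simp only: of_int_less_iff)
  moreover have sq: "(m * \<epsilon>)\<^sup>2 = m\<^sup>2" using \<epsilon>(1) by auto
  ultimately have "4 * (g * d) + m\<^sup>2 \<le> 4 * (m * a)"
    using m \<epsilon>(1) trace_lower_bound[OF mem] by auto
  then have "real_of_int (4 * (g * d) + m\<^sup>2) \<le> of_int (4 * (m * a))" by (simp only: of_int_le_iff)
  then have "4 * real_of_int (g * d) + (of_int m)\<^sup>2 \<le> 4 * (of_int m * of_int a)" by simp
  with ma have "4 * (sP * sP) + (of_int m)\<^sup>2 < 4 * (of_int m * (sP + sQ + sR + 4))"
    unfolding s_mult by linarith
  moreover have "(u - v / 2)\<^sup>2 = (4 * (u * u) + v\<^sup>2) / 4 - v * u" for u v :: real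
    by (simp add: power2_eq_square algebra_simps)
  moreover have "of_int m * (sP + sQ + sR + 4) = of_int m * sP + of_int m * (sQ + sR + 4)"
    by (simp add: distrib_left)
  ultimately show False using large by simp
qed

end

section \<open>Passage from p, q to g, d, e\<close>

lemma squarefree_int_of_nat: "squarefree (n :: nat) \<Longrightarrow> squarefree (int n)"
proof (rule squarefreeI)
  fix x :: int
  assume n: "squarefree n" and "x\<^sup>2 dvd int n"
  then have "int ((nat \<bar>x\<bar>)\<^sup>2) dvd int n" by simp
  then have "(nat \<bar>x\<bar>)\<^sup>2 dvd n" by (simp only: int_dvd_int_iff)
  with n have "nat \<bar>x\<bar> dvd 1" unfolding squarefree_def by blast
  then show "x dvd 1" by simp
qed

text \<open>Dividing by the gcd leaves coprime squarefree cofactors, so d e is squarefree. Modulo 4,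
  both cofactors are inverse to g, hence d e \<equiv> 1. The order g < d < e restates q < r and p <
  q.\<close>

lemma biquad_decomposition:
  fixes p q :: nat and r :: real
  assumes "p \<ge> 2" "q \<ge> 2" "squarefree p" "squarefree q"
    and "[p = 1] (mod 4)" "[q = 1] (mod 4)"
    and r: "r = real (p * q) / real ((gcd p q)\<^sup>2)"
    and "p < q" "real q < r"
  obtains g d e :: int where "biquad g d e" "int p = g * d" "int q = g * e" "r = of_int (d * e)"
    "g < d" "d < e"
proof -
  define k where "k = gcd p q"
  have k: "k > 0" using assms(1) by (simp add: k_def)
  obtain d e where de: "p = k * d" "q = k * e" by (metis dvd_def gcd_dvd1 gcd_dvd2 k_def)
  have "coprime d e"
  proof -
    have "coprime (p div k) (q div k)"
      unfolding k_def using assms(1) by (intro div_gcd_coprime) simp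
    then show ?thesis using de k by simp
  qed
  moreover have "squarefree d" "squarefree e"
    using assms(3,4) de by (metis dvd_triv_right squarefree_mono)+
  ultimately have "squarefree (d * e)" by (rule squarefree_mult_coprime)
  have r': "r = real (d * e)" using k unfolding r k_def[symmetric] unfolding de by (simp add: power2_eq_square)
  then have q_less: "q < d * e" using assms(9) by (simp only: of_nat_less_iff)
  have d_less_e: "d < e" using assms(8) k by (simp add: de)
  with q_less have k_less_d: "k < d" by (simp add: de)
  have p4: "p mod 4 = 1" "q mod 4 = 1" using assms(5,6) by (simp_all add: cong_def)
  have "d * e mod 4 = 1"
  proof -
    have "k * d mod 4 = 1" "k * e mod 4 = 1" using p4 de by simp_all
    then have "(k mod 4) * (d mod 4) mod 4 = 1" "(k mod 4) * (e mod 4) mod 4 = 1"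
      by (simp_all add: mod_mult_eq)
    moreover have "k mod 4 \<in> {0, 1, 2, 3}" "d mod 4 \<in> {0, 1, 2, 3}" "e mod 4 \<in> {0, 1, 2, 3}"
      by auto
    ultimately have "(d mod 4) * (e mod 4) mod 4 = 1" by auto
    then show ?thesis by (simp add: mod_mult_eq)
  qed
  have int_eq: "int p = int k * int d" "int q = int k * int e" using de by simp_all
  show ?thesis
  proof (rule that[OF _ int_eq])
    show "biquad (int k) (int d) (int e)"
    proof
      show "int k > 0" "int d > 0" "int e > 0" using k k_less_d d_less_e by simp_all
      show "squarefree (int k * int d)" "squarefree (int k * int e)" "squarefree (int d * int e)"
        using squarefree_int_of_nat[OF assms(3)] squarefree_int_of_nat[OF assms(4)]
          squarefree_int_of_nat[OF \<open>squarefree (d * e)\<close>] int_eq by simp_all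
      show "int k * int d > 1" "int k * int e > 1" unfolding int_eq[symmetric] using assms(1,2) by simp_all
      have "1 < d * e" using q_less assms(2) by linarith
      then have "int 1 < int (d * e)" by (simp only: of_nat_less_iff)
      then show "int d * int e > 1" by simp
      show "int k * int d mod 4 = 1" "int k * int e mod 4 = 1"
        unfolding int_eq[symmetric] using p4 by presburger+
      have "int (d * e) mod 4 = 1" using \<open>d * e mod 4 = 1\<close> by presburger
      then show "int d * int e mod 4 = 1" by simp
    qed
    show "r = of_int (int d * int e)" by (simp add: r')
    show "int k < int d" "int d < int e" using k_less_d d_less_e by simp_all
  qed
qed

section \<open>Numerical estimates for the subfields and for K\<close>

theorem corollary7p2:
  fixes p q m :: nat and r :: real and K F1 F2 :: "real set" and N1 N2 :: real
  assumes "p \<ge> 2" and "q \<ge> 2" and "squarefree p" and "squarefree q"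
    and "[p = 1] (mod 4)" and "[q = 1] (mod 4)"
    and r: "r = real (p * q) / real ((gcd p q)\<^sup>2)"
    and "p < q" and "real q < r"
    and K: "K = rat_adjoin {sqrt (real p), sqrt (real q)}"
    and F1: "F1 = rat_adjoin {sqrt (real p)}"
    and F2: "F2 = rat_adjoin {sqrt (real q)}"
    and "m > 0"
    and N1: "N1 = (sqrt (real q) + sqrt r + 4) / 4"
    and N2: "N2 = (sqrt (real p) + sqrt r + 4) / 4"
  shows
    "((\<exists>\<kappa>::nat. \<kappa> > 0 \<and>
          real m \<le> min (r / (16 * (real \<kappa> * sqrt r + 1))) (min (real p) (real q))) \<and>
      p \<ge> (m + 8)\<^sup>2 \<and> q \<ge> (m + 8)\<^sup>2 \<longrightarrow>
        \<not> (\<lambda>\<alpha>. real m * \<alpha>) ` tot_pos_integers F1 \<subseteq> sums_of_squares (ring_of_integers K) \<and>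
        \<not> (\<lambda>\<alpha>. real m * \<alpha>) ` tot_pos_integers F2 \<subseteq> sums_of_squares (ring_of_integers K)) \<and>
     (sqrt (real p) + sqrt (real q) + 1 > sqrt r \<and>
      (\<exists>\<kappa>::nat. \<kappa> > 0 \<and> ([gcd p q = 1] (mod 4) \<longrightarrow> even \<kappa>) \<and>
          real m < sqrt r / (24 * real \<kappa>)) \<and>
      real p \<ge> (real m / 2 + 2 * sqrt (real m * N1))\<^sup>2 \<and>
      real q \<ge> (real m + sqrt (8 * real m * N2))\<^sup>2 \<longrightarrow>
        \<not> (\<lambda>\<alpha>. real m * \<alpha>) ` tot_pos_integers K \<subseteq> sums_of_squares (ring_of_integers K))"
proof -
  obtain g d e :: int where "biquad g d e" and p: "int p = g * d" and q: "int q = g * e"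
    and r': "r = of_int (d * e)" and less: "g < d" "d < e"
    using biquad_decomposition[OF assms(1-6) r assms(8,9)] by metis
  interpret biquad g d e by fact
  \<comment> \<open>Exchanging d and e makes \<surd>q the distinguished root, so the results for
    \<rat>(\<surd>p) apply to F2.\<close>
  have "biquad g e d" by (intro biquad.intro) (use pos sqf gt mod4 in \<open>simp_all add: mult.commute\<close>)
  then interpret B2: biquad g e d .
  have sqrt_pq: "sqrt (real p) = sP" "sqrt (real q) = sQ"
    unfolding sP_def sQ_def p[symmetric] q[symmetric] by simp_all
  have sqrt_r: "sqrt r = sR" unfolding sR_def r' ..
  have B2: "B2.sP = sQ" "B2.sQ = sP" "B2.sR = sR"
    unfolding B2.sP_def B2.sQ_def B2.sR_def sP_def sQ_def sR_def by (simp_all only: mult.commute)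
  have fields: "K = rat_adjoin {sP, sQ}" "F1 = rat_adjoin {sP}" "F2 = rat_adjoin {sQ}"
    unfolding assms sqrt_pq by (rule refl)+
  have K2: "rat_adjoin {sQ, sP} = rat_adjoin {sP, sQ}" by (simp only: insert_commute)
  define \<mu> where "\<mu> = real m"
  have \<mu>: "\<mu> = of_int (int m)" "\<mu> \<ge> 1" using assms(13) by (simp_all add: \<mu>_def)
  have r_sq: "r = sR * sR" unfolding r' s_mult ..
  have "sQ < sR"
    unfolding sqrt_pq[symmetric] sqrt_r[symmetric] using assms(9) by (rule real_sqrt_less_mono)
  have "sP < sQ"
    unfolding sqrt_pq[symmetric] using assms(8) by simp
  have part1: "\<not> (\<lambda>\<alpha>. \<mu> * \<alpha>) ` tot_pos_integers F1 \<subseteq> sums_of_squares (ring_of_integers K) \<and>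
      \<not> (\<lambda>\<alpha>. \<mu> * \<alpha>) ` tot_pos_integers F2 \<subseteq> sums_of_squares (ring_of_integers K)"
    if \<kappa>: "(\<kappa>::nat) > 0" "\<mu> \<le> r / (16 * (real \<kappa> * sqrt r + 1))"
      and large: "p \<ge> (m + 8)\<^sup>2" "q \<ge> (m + 8)\<^sup>2" for \<kappa>
  proof -
    have "real \<kappa> * sR + 1 > 0" using s_pos by (intro add_nonneg_pos mult_nonneg_nonneg) simp_all
    \<comment> \<open>The bound on m is weakest for \<kappa> = 1, so it may be replaced by that
      case.\<close>
    have "1 * sR \<le> real \<kappa> * sR" using \<kappa>(1) s_pos by (intro mult_right_mono) simp_all
    then have "r / (16 * (real \<kappa> * sqrt r + 1)) \<le> r / (16 * (sR + 1))"
      unfolding sqrt_r r_sq using s_pos \<open>real \<kappa> * sR + 1 > 0\<close>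
      by (intro divide_left_mono mult_pos_pos) simp_all
    with \<kappa>(2) have "\<mu> \<le> r / (16 * (sR + 1))" by linarith
    then have bound: "\<mu> * (16 * (sR + 1)) \<le> sR * sR"
      unfolding r_sq using s_pos by (subst (asm) pos_le_divide_eq) simp_all
    have "16 * \<mu> * sR < sR * sR" using bound \<mu>(2) by (simp add: algebra_simps)
    then have \<mu>_R: "16 * \<mu> < sR" using s_pos by (subst (asm) mult_less_cancel_right_pos) simp_all
    have de: "d * e > 256 * (int m)\<^sup>2"
    proof -
      have "(16 * \<mu>)\<^sup>2 < sR\<^sup>2" using \<mu>_R \<mu>(2) by (intro power_strict_mono) simp_all
      then have "real_of_int (256 * (int m)\<^sup>2) < of_int (d * e)"
        unfolding power2_eq_square[of sR] s_mult \<mu>(1) by (simp add: power_mult_distrib)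
      then show ?thesis by (simp only: of_int_less_iff)
    qed
    have "int ((m + 8)\<^sup>2) \<le> int p" "int ((m + 8)\<^sup>2) \<le> int q" using large by (simp_all only: of_nat_le_iff)
    then have large': "(int m + 8)\<^sup>2 \<le> g * d" "(int m + 8)\<^sup>2 \<le> g * e" unfolding p q by simp_all
    have m: "int m > 0" using assms(13) by simp
    have e: "e > 4 * int m"
    proof (rule ccontr)
      assume "\<not> e > 4 * int m"
      then have "d * e \<le> (4 * int m) * (4 * int m)"
        using less pos by (intro mult_mono) simp_all
      also have "\<dots> = 16 * (int m)\<^sup>2" by (simp add: power2_eq_square)
      finally show False using de zero_le_power2[of "int m"] by linarith
    qed
    have F1': "\<not> (\<lambda>\<alpha>. \<mu> * \<alpha>) ` tot_pos_integers F1 \<subseteq> sums_of_squares (ring_of_integers K)"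
      unfolding fields \<mu>(1) by (rule not_all_multiples_sums_of_squares[OF m e large'(1)])
    have F2': "\<not> (\<lambda>\<alpha>. of_int (int m) * \<alpha>) ` tot_pos_integers (rat_adjoin {B2.sP})
        \<subseteq> sums_of_squares (ring_of_integers (rat_adjoin {B2.sP, B2.sQ}))"
    \<comment> \<open>The descent for F2 asks for d > 4m. Otherwise r > 256m^2 makes e exceed 64m,
      more than 16 times d, so q \<ge> 16(m + 8)^2. Then \<surd>q is far enough from m for the trace
      argument.\<close>
    proof (cases "d > 4 * int m")
      case True
      show ?thesis by (rule B2.not_all_multiples_sums_of_squares[OF m True large'(2)])
    next
      case False
      have "64 * int m < e"
      proof (rule ccontr)
        assume "\<not> 64 * int m < e"
        then have "d * e \<le> (4 * int m) * (64 * int m)"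
          using False pos by (intro mult_mono) simp_all
        also have "\<dots> = 256 * (int m)\<^sup>2" by (simp add: power2_eq_square)
        finally show False using de by linarith
      qed
      then have "g * (64 * int m) \<le> g * e" using pos by (intro mult_left_mono) simp_all
      moreover have "g * d \<le> g * (4 * int m)" using False pos by (intro mult_left_mono) simp_all
      ultimately have "16 * (int m + 8)\<^sup>2 \<le> g * e" using large'(1) by linarith
      then have "real_of_int (16 * (int m + 8)\<^sup>2) \<le> of_int (g * e)" by (simp only: of_int_le_iff)
      then have "(4 * (\<mu> + 8))\<^sup>2 \<le> of_int (g * e)" unfolding \<mu>(1) power_mult_distrib by simp
      then have Q: "4 * (\<mu> + 8) \<le> sQ" unfolding sQ_def by (rule real_le_rsqrt)
      show ?thesis
      proof (rule B2.not_all_multiples_by_trace[OF m])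
        have "(int m)\<^sup>2 \<le> (int m + 8)\<^sup>2" by (intro power_mono) simp_all
        with large'(2) show "(int m)\<^sup>2 \<le> g * e" by linarith
        \<comment> \<open>The constant 16 in the bound on m pays for this: \<surd>q + 2 < 2(\<surd>r
          + 1), and 16\<mu>(\<surd>r + 1) \<le> r.\<close>
        have "8 * \<mu> * (sQ + 2) < 8 * \<mu> * (2 * (sR + 1))"
          using \<open>sQ < sR\<close> \<mu>(2) s_pos by (intro mult_strict_left_mono) simp_all
        also have "\<dots> \<le> sR * sR" using bound by (simp add: algebra_simps)
        finally show "8 * of_int (int m) * (B2.sP + 2) < of_int (e * d)"
          unfolding s_mult B2 \<mu>(1) by (simp only: mult.commute)
        have "(3 * \<mu> + 32)\<^sup>2 \<le> (sQ - \<mu>)\<^sup>2" using Q \<mu>(2) by (intro power_mono) simp_all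
        moreover have "(3 * \<mu> + 32)\<^sup>2 = (3 * \<mu>)\<^sup>2 + 192 * \<mu> + 1024"
          by (simp add: power2_eq_square algebra_simps)
        moreover have "(3 * \<mu>)\<^sup>2 \<ge> 0" by simp
        ultimately have "4 * \<mu> < (sQ - \<mu>)\<^sup>2" using \<mu>(2) by linarith
        then show "4 * of_int (int m) < (B2.sP - of_int (int m))\<^sup>2" unfolding B2 \<mu>(1) .
      qed
    qed
    then have "\<not> (\<lambda>\<alpha>. \<mu> * \<alpha>) ` tot_pos_integers F2 \<subseteq> sums_of_squares (ring_of_integers K)"
      unfolding fields \<mu>(1) B2 K2 .
    with F1' show ?thesis by blast
  qed
  have part2: "\<not> (\<lambda>\<alpha>. \<mu> * \<alpha>) ` tot_pos_integers K \<subseteq> sums_of_squares (ring_of_integers K)"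
    if \<kappa>: "(\<kappa>::nat) > 0" "\<mu> < sqrt r / (24 * real \<kappa>)"
      and large: "real p \<ge> (\<mu> / 2 + 2 * sqrt (\<mu> * N1))\<^sup>2" for \<kappa>
  proof -
    have "sqrt r / (24 * real \<kappa>) \<le> sqrt r / (24 * 1)"
      unfolding sqrt_r using s_pos \<kappa>(1) by (intro divide_left_mono mult_left_mono mult_pos_pos) simp_all
    with \<kappa>(2) have \<mu>_R: "24 * \<mu> < sR" unfolding sqrt_r by simp
    have N1': "N1 = (sQ + sR + 4) / 4" unfolding N1 sqrt_pq sqrt_r ..
    have "N1 \<ge> 0" unfolding N1' using s_pos by simp
    then have root: "sqrt (\<mu> * N1) \<ge> 0" "sqrt (\<mu> * N1) * sqrt (\<mu> * N1) = \<mu> * N1"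
      using \<mu>(2) by simp_all
    \<comment> \<open>Taking the root of the hypothesis on p before moving \<mu>/2 across keeps both
      sides nonnegative; squaring again gives \<open>large'\<close>, as 4 N1 = \<surd>q + \<surd>r +
      4.\<close>
    have "\<mu> / 2 + 2 * sqrt (\<mu> * N1) \<le> sP"
      unfolding sqrt_pq(1)[symmetric] by (rule real_le_rsqrt[OF large])
    then have P: "2 * sqrt (\<mu> * N1) \<le> sP - \<mu> / 2" by simp
    then have "(2 * sqrt (\<mu> * N1))\<^sup>2 \<le> (sP - \<mu> / 2)\<^sup>2" using root(1) by (intro power_mono) simp_all
    moreover have "(2 * sqrt (\<mu> * N1))\<^sup>2 = 4 * (\<mu> * N1)"
      unfolding power_mult_distrib power2_eq_square[of "sqrt (\<mu> * N1)"] root(2) by simp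
    moreover have "4 * (\<mu> * N1) = \<mu> * (sQ + sR + 4)" unfolding N1' by simp
    ultimately have large': "\<mu> * (sQ + sR + 4) \<le> (sP - \<mu> / 2)\<^sup>2" by linarith
    have m2: "(int m)\<^sup>2 \<le> 4 * (g * d)"
    proof -
      have "\<mu> \<le> 2 * sP" using P root(1) by linarith
      then have "\<mu>\<^sup>2 \<le> (2 * sP)\<^sup>2" using \<mu>(2) by (intro power_mono) simp_all
      then have "\<mu>\<^sup>2 \<le> 4 * (sP * sP)" by (simp add: power2_eq_square)
      then have "real_of_int ((int m)\<^sup>2) \<le> of_int (4 * (g * d))" unfolding s_mult \<mu>(1) by simp
      then show ?thesis by (simp only: of_int_le_iff)
    qed
    have small: "4 * \<mu> * (sP + sQ + sR + 4) < sR * sR"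
    proof -
      \<comment> \<open>Since \<surd>r is the largest root and exceeds 24, 6\<surd>r bounds the sum;
        times 4m this is 24m\<surd>r, which explains the constant 24.\<close>
      have "sP + sQ + sR + 4 \<le> 6 * sR" using \<open>sP < sQ\<close> \<open>sQ < sR\<close> \<mu>_R \<mu>(2) by linarith
      then have "4 * \<mu> * (sP + sQ + sR + 4) \<le> 4 * \<mu> * (6 * sR)" using \<mu>(2) by (intro mult_left_mono) simp_all
      also have "\<dots> = 24 * \<mu> * sR" by simp
      also have "\<dots> < sR * sR" using \<mu>_R s_pos by (intro mult_strict_right_mono) simp_all
      finally show ?thesis .
    qed
    have m: "int m > 0" using assms(13) by simp
    show ?thesis unfolding fields \<mu>(1)
      by (rule not_all_multiples_in_K[OF m m2 small[unfolded s_mult \<mu>(1)] large'[unfolded \<mu>(1)]])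
  qed
  show ?thesis using part1 part2 unfolding \<mu>_def by auto
qed

end
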